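(* Let $q\in(1,\infty]$ and $1/p+1/q=1$, and consider any one of the following settings: (i) (linear regression) $\rho=2$, $l(x,y;\beta)=(y-\beta^Tx)^2$, $c((x,y),(u,v))=N_q((x,y),(u,v))^2$; (ii) (classification, responses in $\{-1,1\}$) $\rho=1$, $c((x,y),(u,v))=N_q((x,y),(u,v))$, and $l$ is either the log-exponential loss $l(x,y;\beta)=\log(1+\exp(-y\beta^Tx))$ (logistic regression) or the hinge loss $l(x,y;\beta)=(1-y\beta^Tx)^+$ (support vector machine). Suppose that the samples $\{(X_i,Y_i):i\le n\}$ are obtained independently from the distribution $\mathbb{P}_*$ and that $\mathbb{E}_{\mathbb{P}_*}\|X\|_2^2<\infty$. For any $1-\alpha\in(1/2,1)$, let $\eta_\alpha$ be the $(1-\alpha)$-quantile of the weak limit $\bar R$ of $n^{\rho/2}R_n(\beta_* )$. If $\delta$ is chosen to be $n^{-\rho/2}\eta$ for some $\eta\ge\eta_\alpha$, then $$\lim_{n\to\infty}\Pr\bigg(\Big|\inf_{\beta\in\mathbb{R}^d}\mathbb{E}_{\mathbb{P}_*}[l(X,Y;\beta)]-\inf_{\beta\in\mathbb{R}^d}\ \sup_{\mathbb{P}\in\mathcal{U}_\delta(\mathbb{P}_n)}\mathbb{E}_{\mathbb{P}}[l(X,Y;\beta)]\Big|<\frac{C}{\sqrt n}\bigg)\ge1-2\alpha,$$ for some positive constant $C$ depending on $\rho$, $\mathbb{E}_{\mathbb{P}_*}[l(X,Y;\beta_* )]$ and $\mathrm{Var}_{\mathbb{P}_*}[l(X,Y;\beta_*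 )]$.
   Context: $X$ takes values in $\mathbb{R}^d$ and $Y$ in $\mathbb{R}$. $\mathbb{P}_n=\frac1n\sum_{i=1}^n\delta_{(X_i,Y_i)}$ is the empirical distribution. $\beta_*\in\mathbb{R}^d$ is the underlying model parameter from which the samples are obtained: in the linear model $Y=\beta_*^TX+e$ with error $e$; in the logistic model $\log\frac{\Pr(Y=1|X=x)}{1-\Pr(Y=1|X=x)}=\beta_*^Tx$. It is optimal, i.e. it minimizes $\beta\mapsto\mathbb{E}_{\mathbb{P}_*}[l(X,Y;\beta)]$. $N_q((x,y),(u,v))=\|x-u\|_q$ if $y=v$, and $=\infty$ otherwise. $\mathcal{D}_c(\mathbb{P},\mathbb{Q})=\inf\{\mathbb{E}_\pi[c(U,V)]\}$, the infimum being over joint distributions $\pi$ on $\mathbb{R}^{d+1}\times\mathbb{R}^{d+1}$ with marginals $\pi_U=\mathbb{P}$, $\pi_V=\mathbb{Q}$. $\mathcal{U}_\delta(\mathbb{P}_n)=\{\mathbb{P}:\mathcal{D}_c(\mathbb{P},\mathbb{P}_n)\le\delta\}$. $R_n(\beta)=\inf\{\mathcal{D}_c(\mathbb{P},\mathbb{P}_n):D_\beta\mathbb{E}_{\mathbb{P}}[l(X,Y;\beta)]=\mathbf 0\}$, where $D_\beta$ is the gradient in $\beta$. $\bar R$ is the limit in distribution, $n^{\rho/2}R_n(\beta_* )\Rightarrow\bar R$, and $\Pr(\bar R\le\eta_\alpha)=1-\alpha$.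
   Formalization: The constant C may also depend on α, η and β_* (hence on d), since no C depending only on ρ and the mean and variance of the loss works for all η≥η_α; the variance of the loss at β_* is assumed finite, and the limit is read as a limit inferior. *)

theory Defs
  imports "HOL-Probability.Probability"
begin

type_synonym 'd point = "(real ^ 'd) \<times> real"

datatype setting = Linear_Regression | Logistic_Regression | Support_Vector_Machine

primrec rho :: "setting \<Rightarrow> nat" where
  "rho Linear_Regression = 2"
| "rho Logistic_Regression = 1"
| "rho Support_Vector_Machine = 1"

primrec loss :: "setting \<Rightarrow> real ^ 'd \<Rightarrow> 'd::finite point \<Rightarrow> real" where
  "loss Linear_Regression b = (\<lambda>(x, y). (y - b \<bullet> x)\<^sup>2)"
| "loss Logistic_Regression b = (\<lambda>(x, y). ln (1 + exp (- y * (b \<bullet> x))))"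
| "loss Support_Vector_Machine b = (\<lambda>(x, y). max 0 (1 - y * (b \<bullet> x)))"

definition lq_norm :: "ereal \<Rightarrow> real ^ 'd::finite \<Rightarrow> real" where
  "lq_norm q x =
    (if q = \<infinity> then (MAX i. \<bar>x $ i\<bar>)
     else (\<Sum>i\<in>UNIV. \<bar>x $ i\<bar> powr real_of_ereal q) powr (1 / real_of_ereal q))"

definition N_dist :: "ereal \<Rightarrow> 'd::finite point \<Rightarrow> 'd point \<Rightarrow> ennreal" where
  "N_dist q = (\<lambda>(x, y) (u, v). if y = v then ennreal (lq_norm q (x - u)) else \<infinity>)"

text \<open>The exponent \<^term>\<open>rho s\<close> gives the squared cost for linear regression and the
  plain cost for the two classification settings.\<close>

definition cost :: "setting \<Rightarrow> ereal \<Rightarrow> 'd::finite point \<Rightarrow> 'd point \<Rightarrow> ennreal" where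
  "cost s q z w = N_dist q z w ^ rho s"

definition borel_prob :: "'b::topological_space measure \<Rightarrow> bool" where
  "borel_prob P \<longleftrightarrow> prob_space P \<and> sets P = sets borel"

definition couplings ::
    "'d::finite point measure \<Rightarrow> 'd point measure \<Rightarrow> ('d point \<times> 'd point) measure set" where
  "couplings P Q =
    {\<pi>. borel_prob \<pi> \<and> distr \<pi> borel fst = P \<and> distr \<pi> borel snd = Q}"

definition transport_cost ::
    "('d::finite point \<Rightarrow> 'd point \<Rightarrow> ennreal) \<Rightarrow> 'd point measure \<Rightarrow> 'd point measure \<Rightarrow> ennreal" where
  "transport_cost c P Q = (INF \<pi>\<in>couplings P Q. \<integral>\<^sup>+ (u, v). c u v \<partial>\<pi>)"

definition ambiguity_set ::
    "('d::finite point \<Rightarrow> 'd point \<Rightarrow> ennreal) \<Rightarrow> real \<Rightarrow> 'd point measure \<Rightarrow> 'd point measure set" where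
  "ambiguity_set c \<delta> Q = {P. borel_prob P \<and> transport_cost c P Q \<le> ennreal \<delta>}"

text \<open>The law \<open>(1/n) \<Sum>\<^sub>i \<delta>(Z i)\<close> of a uniformly chosen sample point.\<close>

definition empirical :: "nat \<Rightarrow> (nat \<Rightarrow> 'd::finite point) \<Rightarrow> 'd point measure" where
  "empirical n z = distr (uniform_count_measure {..<n}) borel z"

text \<open>All losses are nonnegative, so expectations that enter an infimum or a supremum are
  taken in \<^typ>\<open>ennreal\<close>, where no integrability or boundedness side conditions arise.\<close>

definition expected_loss :: "setting \<Rightarrow> 'd::finite point measure \<Rightarrow> real ^ 'd \<Rightarrow> ennreal" where
  "expected_loss s P b = (\<integral>\<^sup>+ z. ennreal (loss s b z) \<partial>P)"

definition optimal_risk :: "setting \<Rightarrow> 'd::finite point measure \<Rightarrow> ennreal" where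
  "optimal_risk s P = (INF b. expected_loss s P b)"

definition robust_risk :: "setting \<Rightarrow> ereal \<Rightarrow> real \<Rightarrow> 'd::finite point measure \<Rightarrow> ennreal" where
  "robust_risk s q \<delta> Q =
    (INF b. SUP P\<in>ambiguity_set (cost s q) \<delta> Q. expected_loss s P b)"

definition mean_loss :: "setting \<Rightarrow> 'd::finite point measure \<Rightarrow> real ^ 'd \<Rightarrow> real" where
  "mean_loss s P b = (\<integral>z. loss s b z \<partial>P)"

definition var_loss :: "setting \<Rightarrow> 'd::finite point measure \<Rightarrow> real ^ 'd \<Rightarrow> real" where
  "var_loss s P b = (\<integral>z. (loss s b z - mean_loss s P b)\<^sup>2 \<partial>P)"

text \<open>Integrability only excludes measures at infinite transport cost from any empirical
  measure, so it does not affect the infimum below.\<close>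

definition stationary :: "setting \<Rightarrow> real ^ 'd::finite \<Rightarrow> 'd point measure \<Rightarrow> bool" where
  "stationary s b P \<longleftrightarrow>
    (\<forall>b'. integrable P (loss s b')) \<and> GDERIV (mean_loss s P) b :> 0"

definition profile :: "setting \<Rightarrow> ereal \<Rightarrow> 'd::finite point measure \<Rightarrow> real ^ 'd \<Rightarrow> ennreal" where
  "profile s q Q b =
    (INF P\<in>{P. borel_prob P \<and> stationary s b P}. transport_cost (cost s q) P Q)"

text \<open>The profile of an empirical measure with \<open>n \<ge> 1\<close> is finite: moving every \<open>X\<close>-coordinate
  to \<open>0\<close> makes the gradient vanish at finite cost. Hence \<^const>\<open>enn2real\<close> loses nothing.\<close>

definition scaled_profile ::
    "setting \<Rightarrow> ereal \<Rightarrow> (nat \<Rightarrow> 'a \<Rightarrow> 'd::finite point) \<Rightarrow> real ^ 'd \<Rightarrow> nat \<Rightarrow> 'a \<Rightarrow> real" where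
  "scaled_profile s q Z b n \<omega> =
    real n powr (real (rho s) / 2) * enn2real (profile s q (empirical n (\<lambda>i. Z i \<omega>)) b)"

definition converges_in_law :: "'a measure \<Rightarrow> (nat \<Rightarrow> 'a \<Rightarrow> real) \<Rightarrow> real measure \<Rightarrow> bool" where
  "converges_in_law M W R \<longleftrightarrow>
    (\<forall>n. W n \<in> borel_measurable M) \<and> real_distribution R \<and>
    weak_conv_m (\<lambda>n. distr M borel (W n)) R"

definition iid_sample :: "'a measure \<Rightarrow> (nat \<Rightarrow> 'a \<Rightarrow> 'd::finite point) \<Rightarrow> 'd point measure \<Rightarrow> bool" where
  "iid_sample M Z P \<longleftrightarrow>
    prob_space M \<and> prob_space.indep_vars M (\<lambda>_. borel) Z UNIV \<and> (\<forall>i. distr M borel (Z i) = P)"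

definition prob_one_given_X :: "'d::finite point measure \<Rightarrow> 'd point \<Rightarrow> real" where
  "prob_one_given_X P =
    real_cond_exp P (vimage_algebra (space P) fst borel) (indicator {z. snd z = 1})"

text \<open>The strict bounds on the conditional probability make the log-odds well defined.
  The linear model \<open>Y = b \<bullet> X + e\<close> needs no clause, as it merely defines the error \<open>e\<close>.\<close>

primrec response_model :: "setting \<Rightarrow> 'd::finite point measure \<Rightarrow> real ^ 'd \<Rightarrow> bool" where
  "response_model Linear_Regression P b \<longleftrightarrow> True"
| "response_model Logistic_Regression P b \<longleftrightarrow>
    (AE z in P. snd z \<in> {-1, 1}) \<and>
    (AE z in P. 0 < prob_one_given_X P z \<and> prob_one_given_X P z < 1 \<and>
       ln (prob_one_given_X P z / (1 - prob_one_given_X P z)) = b \<bullet> fst z)"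
| "response_model Support_Vector_Machine P b \<longleftrightarrow> (AE z in P. snd z \<in> {-1, 1})"

definition optimal_parameter :: "setting \<Rightarrow> 'd::finite point measure \<Rightarrow> real ^ 'd \<Rightarrow> bool" where
  "optimal_parameter s P b \<longleftrightarrow> (\<forall>b'. expected_loss s P b \<le> expected_loss s P b')"

end

theory Submission
  imports Defs
begin

text \<open>
  For an empirical measure the inner supremum of the robust risk has a closed form in terms of the
  norm dual to the transport cost: \<open>(sqrt A + sqrt \<delta> * D)\<^sup>2\<close> for linear regression and
  \<open>A + \<delta> * D * max \<bar>y\<bar>\<close> for the two classification losses, where \<open>A\<close> is the empirical loss and
  \<open>D\<close> the dual norm of the parameter. Its value at \<open>\<beta>\<close> bounds the robust risk from above by the
  empirical loss up to order \<open>1 / sqrt n\<close>.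
  Conversely, whenever the scaled profile is below \<open>\<eta>\<close>, the ambiguity set contains a measure for which
  \<open>\<beta>\<close> is stationary, hence optimal by convexity, and whose risk at \<open>\<beta>\<close> differs from the empirical
  loss by order \<open>1 / sqrt n\<close>; so the robust risk is bounded from below as well.
  The empirical loss itself is within \<open>K / sqrt n\<close> of the optimal risk by Chebyshev's inequality, and
  \<open>K\<close> is chosen so that this fails with probability at most \<open>\<alpha> / 2\<close>.
  The closed form also yields the measurability of the robust risk: being continuous in the parameter,
  it can be minimized over a countable dense set.
\<close>

subsection \<open>The dual norm\<close>

text \<open>This coordinate bound is the source of nonnegativity and definiteness of
  \<open>lq_norm\<close>, and of the finiteness of its dual.\<close>

lemma abs_component_le_lq_norm:
  assumes "1 < q"
  shows "\<bar>w $ i\<bar> \<le> lq_norm q w"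
proof (cases "q = \<infinity>")
  case True
  then show ?thesis unfolding lq_norm_def by (auto intro!: Max_ge)
next
  case False
  then obtain r where r: "q = ereal r" "1 < r" using assms by (cases q) auto
  have "\<bar>w $ i\<bar> powr r \<le> (\<Sum>i\<in>UNIV. \<bar>w $ i\<bar> powr r)"
    by (rule member_le_sum) auto
  then have "(\<bar>w $ i\<bar> powr r) powr (1 / r) \<le> (\<Sum>i\<in>UNIV. \<bar>w $ i\<bar> powr r) powr (1 / r)"
    using r by (intro powr_mono2) auto
  then show ?thesis using r by (simp add: lq_norm_def powr_powr)
qed

lemma lq_norm_nonneg: "1 < q \<Longrightarrow> 0 \<le> lq_norm q w"
  using abs_component_le_lq_norm[of q w undefined] by linarith

lemma lq_norm_scaleR:
  assumes "1 < q"
  shows "lq_norm q (c *\<^sub>R w) = \<bar>c\<bar> * lq_norm q w"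
proof (cases "q = \<infinity>")
  case True
  have "Max (range (\<lambda>i. \<bar>c\<bar> * \<bar>w $ i\<bar>)) = \<bar>c\<bar> * Max (range (\<lambda>i. \<bar>w $ i\<bar>))"
    using mono_Max_commute[of "\<lambda>x. \<bar>c\<bar> * x" "range (\<lambda>i. \<bar>w $ i\<bar>)"]
    by (simp add: mono_def mult_left_mono image_image)
  then show ?thesis using True by (simp add: lq_norm_def abs_mult)
next
  case False
  then obtain r where r: "q = ereal r" "1 < r" using assms by (cases q) auto
  have "(\<Sum>i\<in>UNIV. \<bar>c * w $ i\<bar> powr r) = \<bar>c\<bar> powr r * (\<Sum>i\<in>UNIV. \<bar>w $ i\<bar> powr r)"
    by (simp add: abs_mult powr_mult sum_distrib_left)
  moreover have "0 \<le> (\<Sum>i\<in>UNIV. \<bar>w $ i\<bar> powr r)" by (intro sum_nonneg) auto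
  ultimately show ?thesis
    using r by (simp add: lq_norm_def powr_mult powr_powr)
qed

lemma lq_norm_zero: "1 < q \<Longrightarrow> lq_norm q 0 = 0"
  using lq_norm_scaleR[of q 0 0] by simp

lemma lq_norm_eq_0:
  assumes "1 < q" "lq_norm q w = 0"
  shows "w = 0"
proof -
  have "w $ i = 0" for i using abs_component_le_lq_norm[OF assms(1), of w i] assms(2) by simp
  then show ?thesis by (simp add: vec_eq_iff)
qed

lemma borel_measurable_lq_norm [measurable]: "lq_norm q \<in> borel_measurable borel"
proof -
  have [measurable]: "(\<lambda>x::real^'d. x $ i) \<in> borel_measurable borel" for i
    by (intro borel_measurable_continuous_onI continuous_intros)
  show ?thesis unfolding lq_norm_def by measurable
qed

text \<open>A crude Hoelder inequality with the l1 norm of \<open>b\<close>. It makes the supremum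
  defining the dual norm a supremum of a bounded set, and that l1 norm is the \<open>B\<close> of
  the final constant.\<close>

lemma inner_le_lq_norm:
  assumes "1 < q"
  shows "b \<bullet> w \<le> (\<Sum>i\<in>UNIV. \<bar>b $ i\<bar>) * lq_norm q w"
proof -
  have "b \<bullet> w = (\<Sum>i\<in>UNIV. b $ i * w $ i)" by (simp add: inner_vec_def)
  also have "\<dots> \<le> (\<Sum>i\<in>UNIV. \<bar>b $ i\<bar> * lq_norm q w)"
  proof (rule sum_mono)
    fix i
    have "b $ i * w $ i \<le> \<bar>b $ i\<bar> * \<bar>w $ i\<bar>" by (metis abs_ge_self abs_mult)
    also have "\<dots> \<le> \<bar>b $ i\<bar> * lq_norm q w"
      by (intro mult_left_mono abs_component_le_lq_norm assms) auto
    finally show "b $ i * w $ i \<le> \<bar>b $ i\<bar> * lq_norm q w" .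
  qed
  finally show ?thesis by (simp add: sum_distrib_right)
qed

text \<open>The dual norm is the \<open>\<ell>\<^sub>p\<close> norm for the conjugate exponent \<open>p\<close>, but only its variational
  characterization matters here.\<close>

definition dual_norm :: "ereal \<Rightarrow> real ^ 'd::finite \<Rightarrow> real" where
  "dual_norm q b = (SUP w\<in>{w. lq_norm q w \<le> 1}. b \<bullet> w)"

lemma inner_le_sum_abs:
  assumes "1 < q" "lq_norm q w \<le> 1"
  shows "b \<bullet> w \<le> (\<Sum>i\<in>UNIV. \<bar>b $ i\<bar>)"
  using inner_le_lq_norm[OF assms(1), of b w]
    mult_left_mono[OF assms(2), of "\<Sum>i\<in>UNIV. \<bar>b $ i\<bar>"] by (simp add: sum_nonneg)

lemma inner_le_dual_norm:
  assumes "1 < q" "lq_norm q w \<le> 1"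
  shows "b \<bullet> w \<le> dual_norm q b"
  unfolding dual_norm_def
  using assms inner_le_sum_abs[OF assms(1)]
  by (intro cSUP_upper bdd_aboveI[where M = "\<Sum>i\<in>UNIV. \<bar>b $ i\<bar>"]) auto

lemma dual_norm_leI:
  assumes "1 < q" "\<And>w. lq_norm q w \<le> 1 \<Longrightarrow> b \<bullet> w \<le> c"
  shows "dual_norm q b \<le> c"
  unfolding dual_norm_def
  using assms by (intro cSUP_least) (auto intro!: exI[of _ 0] simp: lq_norm_zero)

lemma dual_norm_nonneg: "1 < q \<Longrightarrow> 0 \<le> dual_norm q b"
  using inner_le_dual_norm[of q 0 b] by (simp add: lq_norm_zero)

lemma dual_norm_le_sum_abs: "1 < q \<Longrightarrow> dual_norm q b \<le> (\<Sum>i\<in>UNIV. \<bar>b $ i\<bar>)"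
  by (intro dual_norm_leI inner_le_sum_abs)

text \<open>Hoelder's inequality for the dual pair, by rescaling \<open>w\<close> to the unit
  sphere; definiteness handles \<open>lq_norm q w = 0\<close>.\<close>

lemma abs_inner_le_dual_norm:
  assumes "1 < q"
  shows "\<bar>b \<bullet> w\<bar> \<le> dual_norm q b * lq_norm q w"
proof (cases "lq_norm q w = 0")
  case True
  then show ?thesis using lq_norm_eq_0[OF assms True] by simp
next
  case False
  then have pos: "0 < lq_norm q w" using lq_norm_nonneg[OF assms, of w] by simp
  \<comment> \<open>The sign \<open>s\<close> yields both halves of the absolute value from one
    normalization.\<close>
  have "s * (b \<bullet> w) \<le> dual_norm q b * lq_norm q w" if "\<bar>s\<bar> = 1" for s
  proof -
    have "b \<bullet> ((s / lq_norm q w) *\<^sub>R w) \<le> dual_norm q b"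
      using pos that by (intro inner_le_dual_norm assms) (simp add: lq_norm_scaleR[OF assms])
    then show ?thesis using pos by (simp add: field_simps)
  qed
  from this[of 1] this[of "-1"] show ?thesis by (simp add: abs_le_iff)
qed

lemma dual_norm_triangle:
  assumes "1 < q"
  shows "dual_norm q (a + b) \<le> dual_norm q a + dual_norm q b"
  by (rule dual_norm_leI[OF assms])
    (auto simp: inner_add_left intro!: add_mono inner_le_dual_norm assms)

text \<open>The triangle inequality and the l1 bound give a Lipschitz constant equal to the
  dimension, since each coordinate of \<open>b - a\<close> is at most the Euclidean distance.
  Continuity later serves to minimize over a countable dense set.\<close>

lemma continuous_dual_norm:
  fixes b :: "real ^ 'd::finite"
  assumes "1 < q"
  shows "continuous_on UNIV (dual_norm q :: real ^ 'd \<Rightarrow> real)"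
proof -
  have le: "dual_norm q b \<le> dual_norm q a + CARD('d) * dist a b" for a b :: "real ^ 'd"
  proof -
    have "dual_norm q b \<le> dual_norm q a + dual_norm q (b - a)"
      using dual_norm_triangle[OF assms, of a "b - a"] by simp
    also have "dual_norm q (b - a) \<le> (\<Sum>i\<in>UNIV. \<bar>(b - a) $ i\<bar>)"
      by (rule dual_norm_le_sum_abs[OF assms])
    also have "\<dots> \<le> (\<Sum>i\<in>(UNIV::'d set). dist a b)"
      by (intro sum_mono) (metis component_le_norm_cart dist_commute dist_norm)
    finally show ?thesis by simp
  qed
  have "\<bar>dual_norm q b - dual_norm q a\<bar> \<le> CARD('d) * dist b a" for a b :: "real ^ 'd"
    using le[of b a] le[of a b] by (auto simp: dist_commute abs_le_iff)
  then have "(real CARD('d))-lipschitz_on UNIV (dual_norm q :: real ^ 'd \<Rightarrow> real)"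
    by (intro lipschitz_onI) (auto simp: dist_real_def)
  then show ?thesis by (rule lipschitz_on_continuous_on)
qed

subsection \<open>Transport\<close>

lemma borel_measurable_cost [measurable]:
  "case_prod (cost s q :: 'b::finite point \<Rightarrow> _) \<in> borel_measurable borel"
proof -
  \<comment> \<open>Couplings live on the Borel sets of the product space, so the projections are
    measurable because they are continuous.\<close>
  have [measurable]: "fst \<in> borel_measurable (borel :: 'b point measure)"
    "snd \<in> borel_measurable (borel :: 'b point measure)"
    "fst \<in> borel_measurable (borel :: ('b point \<times> 'b point) measure)"
    "snd \<in> borel_measurable (borel :: ('b point \<times> 'b point) measure)"
    by (intro borel_measurable_continuous_onI continuous_intros)+
  have eq: "case_prod (cost s q) = (\<lambda>z :: 'b point \<times> 'b point.
      (if snd (fst z) = snd (snd z) then ennreal (lq_norm q (fst (fst z) - fst (snd z))) else \<infinity>) ^ rho s)"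
    by (auto simp: cost_def N_dist_def fun_eq_iff)
  show ?thesis unfolding eq by measurable
qed

lemma cost_eq:
  "cost s q z w = (if snd z = snd w then ennreal (lq_norm q (fst z - fst w)) ^ rho s else \<infinity>)"
  by (cases s; cases z; cases w) (auto simp: cost_def N_dist_def)

lemma borel_measurable_loss [measurable]: "loss s b \<in> borel_measurable borel"
proof -
  have [measurable]: "fst \<in> borel_measurable (borel :: 'b point measure)"
    "snd \<in> borel_measurable (borel :: 'b::finite point measure)"
    by (intro borel_measurable_continuous_onI continuous_intros)+
  show ?thesis
    by (cases s) (simp_all add: case_prod_unfold)
qed

lemma loss_nonneg: "0 \<le> loss s b z"
  by (cases s) (auto simp: case_prod_unfold)

text \<open>Two random variables on one probability space are coupled by their joint law.\<close>

lemma transport_cost_distr_le: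
  assumes N: "prob_space N" and [measurable]: "X \<in> borel_measurable N" "Y \<in> borel_measurable N"
  shows "transport_cost (cost s q) (distr N borel X) (distr N borel Y)
    \<le> (\<integral>\<^sup>+ x. cost s q (X x) (Y x) \<partial>N)"
proof -
  have [measurable]: "(\<lambda>x. (X x, Y x)) \<in> borel_measurable N"
    by (rule borel_measurable_Pair) measurable
  have [measurable]: "fst \<in> borel_measurable (borel :: ('b point \<times> 'b point) measure)"
    "snd \<in> borel_measurable (borel :: ('b::finite point \<times> 'b point) measure)"
    by (intro borel_measurable_continuous_onI continuous_intros)+
  let ?\<pi> = "distr N borel (\<lambda>x. (X x, Y x))"
  have "?\<pi> \<in> couplings (distr N borel X) (distr N borel Y)"
    using N by (auto simp: couplings_def borel_prob_def distr_distr comp_def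
        intro!: prob_space.prob_space_distr)
  then have "transport_cost (cost s q) (distr N borel X) (distr N borel Y)
      \<le> (\<integral>\<^sup>+ (u, v). cost s q u v \<partial>?\<pi>)"
    unfolding transport_cost_def by (rule INF_lower)
  also have "\<dots> = (\<integral>\<^sup>+ x. cost s q (X x) (Y x) \<partial>N)"
    by (subst nn_integral_distr) auto
  finally show ?thesis .
qed

text \<open>The infimum defining the transport cost need not be attained, hence the detour
  through near-optimal couplings.\<close>

lemma le_transport_cost:
  assumes fin: "transport_cost c P Q \<le> ennreal \<delta>" and K: "0 \<le> K" and \<delta>: "0 \<le> \<delta>"
    and le: "\<And>\<pi>. \<pi> \<in> couplings P Q \<Longrightarrow> (\<integral>\<^sup>+ (u, v). c u v \<partial>\<pi>) < \<infinity> \<Longrightarrow> a \<le> b + ennreal K * (\<integral>\<^sup>+ (u, v). c u v \<partial>\<pi>)"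
  shows "a \<le> b + ennreal (K * \<delta>)"
proof (rule ennreal_le_epsilon)
  fix e :: real assume e: "0 < e"
  \<comment> \<open>The denominator \<open>K + 1\<close> also covers \<open>K = 0\<close> and still
    gives \<open>K * e' \<le> e\<close>.\<close>
  define e' where "e' = e / (K + 1)"
  have e': "0 < e'" using e K by (simp add: e'_def)
  have "transport_cost c P Q < ennreal (\<delta> + e')"
    using fin e' \<delta> by (intro le_less_trans[OF fin] ennreal_lessI) auto
  then obtain \<pi> where \<pi>: "\<pi> \<in> couplings P Q" "(\<integral>\<^sup>+ (u, v). c u v \<partial>\<pi>) < ennreal (\<delta> + e')"
    unfolding transport_cost_def by (auto simp: INF_less_iff)
  have "K * e' \<le> e" using K e unfolding e'_def by (simp add: field_simps)
  have "a \<le> b + ennreal K * ennreal (\<delta> + e')"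
    using le[OF \<pi>(1)] \<pi>(2) order_less_le_trans[OF \<pi>(2) top_greatest, folded infinity_ennreal_def]
    by (meson add_left_mono less_imp_le mult_left_mono order_trans zero_le)
  also have "\<dots> = b + ennreal (K * \<delta> + K * e')"
    using K \<delta> e' by (simp add: ennreal_mult[symmetric] distrib_left)
  also have "\<dots> \<le> b + ennreal (K * \<delta> + e)"
    using \<open>K * e' \<le> e\<close> by (intro add_left_mono ennreal_leI) auto
  finally show "a \<le> b + ennreal (K * \<delta>) + ennreal e"
    using K \<delta> e by (simp add: ennreal_plus add.assoc)
qed

text \<open>A pointwise growth bound is integrated against a coupling. \<open>F\<close> and
  \<open>G\<close> take the whole pair, so that either marginal can stand on the left;
  \<open>S\<close> carries the mass of \<open>Q\<close> and allows constants \<open>K\<close> that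
  are uniform only there.\<close>

lemma le_transport_cost_pointwise:
  fixes P Q :: "'d::finite point measure" and F G :: "'d point \<Rightarrow> 'd point \<Rightarrow> real"
  assumes q: "1 < q" and fin: "transport_cost (cost s q) P Q \<le> ennreal \<delta>"
    and K: "0 \<le> K" and \<delta>: "0 \<le> \<delta>"
    and S: "AE v in Q. v \<in> S" "S \<in> sets borel"
    and F [measurable]: "case_prod F \<in> borel_measurable borel"
    and G [measurable]: "case_prod G \<in> borel_measurable borel"
    and G_nonneg: "\<And>u v. 0 \<le> G u v"
    and le: "\<And>u v. v \<in> S \<Longrightarrow> snd u = snd v \<Longrightarrow> F u v \<le> G u v + K * lq_norm q (fst u - fst v) ^ rho s"
    and a: "\<And>\<pi>. \<pi> \<in> couplings P Q \<Longrightarrow> a = (\<integral>\<^sup>+ (u, v). ennreal (F u v) \<partial>\<pi>)"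
    and b: "\<And>\<pi>. \<pi> \<in> couplings P Q \<Longrightarrow> b = (\<integral>\<^sup>+ (u, v). ennreal (G u v) \<partial>\<pi>)"
  shows "a \<le> b + ennreal (K * \<delta>)"
proof (rule le_transport_cost[OF fin K \<delta>])
  fix \<pi> assume \<pi>: "\<pi> \<in> couplings P Q" and finite: "(\<integral>\<^sup>+ (u, v). cost s q u v \<partial>\<pi>) < \<infinity>"
  have sets [measurable_cong]: "sets \<pi> = sets borel" and snd: "distr \<pi> borel snd = Q"
    using \<pi> by (auto simp: couplings_def borel_prob_def)
  have [measurable]: "snd \<in> measurable \<pi> (borel :: 'd point measure)"
    unfolding measurable_cong_sets[OF sets refl]
    by (intro borel_measurable_continuous_onI continuous_intros)
  have "AE z in \<pi>. snd z \<in> S"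
    using S unfolding snd[symmetric] by (subst (asm) AE_distr_iff) auto
  \<comment> \<open>Pairs with different responses cost infinity, so a coupling of finite cost gives
    them no mass.\<close>
  moreover have "AE z in \<pi>. case_prod (cost s q) z \<noteq> \<infinity>"
    using finite by (intro nn_integral_PInf_AE) auto
  ultimately have AE: "AE z in \<pi>. ennreal (case_prod F z)
      \<le> ennreal (case_prod G z) + ennreal K * case_prod (cost s q) z"
  proof eventually_elim
    case (elim z)
    obtain u v where z: "z = (u, v)" by (cases z)
    from elim z have y: "snd u = snd v" and v: "v \<in> S" by (auto simp: cost_eq split: if_splits)
    have "ennreal (F u v) \<le> ennreal (G u v + K * lq_norm q (fst u - fst v) ^ rho s)"
      by (intro ennreal_leI le v y)
    also have "\<dots> = ennreal (G u v) + ennreal K * ennreal (lq_norm q (fst u - fst v)) ^ rho s"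
      using K lq_norm_nonneg[OF q, of "fst u - fst v"] G_nonneg[of u v]
      by (subst ennreal_plus) (auto simp: ennreal_mult ennreal_power)
    finally show ?case using y z by (simp add: cost_eq)
  qed
  have "a = (\<integral>\<^sup>+ z. ennreal (case_prod F z) \<partial>\<pi>)" unfolding a[OF \<pi>] by (simp add: case_prod_unfold)
  also have "\<dots> \<le> (\<integral>\<^sup>+ z. ennreal (case_prod G z) + ennreal K * case_prod (cost s q) z \<partial>\<pi>)"
    by (rule nn_integral_mono_AE[OF AE])
  also have "\<dots> = (\<integral>\<^sup>+ z. ennreal (case_prod G z) \<partial>\<pi>) + ennreal K * (\<integral>\<^sup>+ z. case_prod (cost s q) z \<partial>\<pi>)"
    by (simp add: nn_integral_add nn_integral_cmult)
  also have "(\<integral>\<^sup>+ z. ennreal (case_prod G z) \<partial>\<pi>) = b" unfolding b[OF \<pi>] by (simp add: case_prod_unfold)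
  finally show "a \<le> b + ennreal K * (\<integral>\<^sup>+ (u, v). cost s q u v \<partial>\<pi>)" .
qed

lemma nn_integral_coupling:
  fixes f :: "'d::finite point \<Rightarrow> real"
  assumes "\<pi> \<in> couplings P Q" and [measurable]: "f \<in> borel_measurable borel"
  shows "(\<integral>\<^sup>+ u. ennreal (f u) \<partial>P) = (\<integral>\<^sup>+ (u, v). ennreal (f u) \<partial>\<pi>)"
    and "(\<integral>\<^sup>+ v. ennreal (f v) \<partial>Q) = (\<integral>\<^sup>+ (u, v). ennreal (f v) \<partial>\<pi>)"
proof -
  have sets [measurable_cong]: "sets \<pi> = sets borel"
    and PQ: "distr \<pi> borel fst = P" "distr \<pi> borel snd = Q"
    using assms by (auto simp: couplings_def borel_prob_def)
  have [measurable]: "fst \<in> measurable \<pi> (borel :: 'd point measure)" "snd \<in> measurable \<pi> (borel :: 'd point measure)"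
    unfolding measurable_cong_sets[OF sets refl]
    by (intro borel_measurable_continuous_onI continuous_intros)+
  show "(\<integral>\<^sup>+ u. ennreal (f u) \<partial>P) = (\<integral>\<^sup>+ (u, v). ennreal (f u) \<partial>\<pi>)"
    and "(\<integral>\<^sup>+ v. ennreal (f v) \<partial>Q) = (\<integral>\<^sup>+ (u, v). ennreal (f v) \<partial>\<pi>)"
    unfolding PQ[symmetric] by (simp_all add: nn_integral_distr case_prod_unfold)
qed

text \<open>The first direction bounds the risk of a perturbed measure from above, the second bounds
  the empirical loss by the risk of the perturbed measure.\<close>

lemma nn_integral_le_transport:
  fixes P Q :: "'d::finite point measure" and f g :: "'d point \<Rightarrow> real"
  assumes q: "1 < q" and fin: "transport_cost (cost s q) P Q \<le> ennreal \<delta>"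
    and K: "0 \<le> K" and \<delta>: "0 \<le> \<delta>"
    and S: "AE v in Q. v \<in> S" "S \<in> sets borel"
    and f: "f \<in> borel_measurable borel" "\<And>z. 0 \<le> f z"
    and g: "g \<in> borel_measurable borel" "\<And>z. 0 \<le> g z"
  shows "(\<And>u v. v \<in> S \<Longrightarrow> snd u = snd v \<Longrightarrow> f u \<le> g v + K * lq_norm q (fst u - fst v) ^ rho s) \<Longrightarrow>
    (\<integral>\<^sup>+ u. ennreal (f u) \<partial>P) \<le> (\<integral>\<^sup>+ v. ennreal (g v) \<partial>Q) + ennreal (K * \<delta>)"
    and "(\<And>u v. v \<in> S \<Longrightarrow> snd u = snd v \<Longrightarrow> g v \<le> f u + K * lq_norm q (fst u - fst v) ^ rho s) \<Longrightarrow>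
    (\<integral>\<^sup>+ v. ennreal (g v) \<partial>Q) \<le> (\<integral>\<^sup>+ u. ennreal (f u) \<partial>P) + ennreal (K * \<delta>)"
proof -
  have meas: "(\<lambda>(u :: 'd point, v :: 'd point). h u) \<in> borel_measurable borel" "(\<lambda>(u :: 'd point, v :: 'd point). h v) \<in> borel_measurable borel"
    if "h \<in> borel_measurable borel" for h :: "'d point \<Rightarrow> real"
  proof -
    have m: "fst \<in> borel_measurable (borel :: ('d point \<times> 'd point) measure)"
      "snd \<in> borel_measurable (borel :: ('d point \<times> 'd point) measure)"
      by (intro borel_measurable_continuous_onI continuous_intros)+
    show "(\<lambda>(u :: 'd point, v :: 'd point). h u) \<in> borel_measurable borel" "(\<lambda>(u :: 'd point, v :: 'd point). h v) \<in> borel_measurable borel"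
      using measurable_compose[OF m(1) that] measurable_compose[OF m(2) that]
      by (simp_all add: case_prod_unfold)
  qed
  show "(\<integral>\<^sup>+ u. ennreal (f u) \<partial>P) \<le> (\<integral>\<^sup>+ v. ennreal (g v) \<partial>Q) + ennreal (K * \<delta>)"
    if "\<And>u v. v \<in> S \<Longrightarrow> snd u = snd v \<Longrightarrow> f u \<le> g v + K * lq_norm q (fst u - fst v) ^ rho s"
    by (rule le_transport_cost_pointwise[OF q fin K \<delta> S, where F = "\<lambda>u v. f u" and G = "\<lambda>u v. g v"])
      (use that f g in \<open>auto intro: nn_integral_coupling meas\<close>)
  show "(\<integral>\<^sup>+ v. ennreal (g v) \<partial>Q) \<le> (\<integral>\<^sup>+ u. ennreal (f u) \<partial>P) + ennreal (K * \<delta>)"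
    if "\<And>u v. v \<in> S \<Longrightarrow> snd u = snd v \<Longrightarrow> g v \<le> f u + K * lq_norm q (fst u - fst v) ^ rho s"
    by (rule le_transport_cost_pointwise[OF q fin K \<delta> S, where F = "\<lambda>u v. g v" and G = "\<lambda>u v. f u"])
      (use that f g in \<open>auto intro: nn_integral_coupling meas\<close>)
qed

section \<open>Growth of the losses under a shift of the covariate\<close>

lemma lq_norm_minus_commute: "1 < q \<Longrightarrow> lq_norm q (x - y) = lq_norm q (y - x)"
  using lq_norm_scaleR[of q "-1" "x - y"] by simp

text \<open>Young's inequality for the square of a residual plus a shift. The parameter
  \<open>t\<close> stays free: it is optimized for the upper bound on the robust risk and set to
  \<open>1 / sqrt n\<close> for the lower one.\<close>

lemma loss_linear_le:
  assumes q: "1 < q" and t: "0 < t" and y: "snd u = snd v"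
  shows "loss Linear_Regression b u \<le> (1 + t) * loss Linear_Regression b v
    + (1 + 1 / t) * (dual_norm q b)\<^sup>2 * (lq_norm q (fst u - fst v))\<^sup>2"
proof -
  define r where "r = snd v - b \<bullet> fst v"
  define d where "d = b \<bullet> (fst v - fst u)"
  have "(r + d)\<^sup>2 \<le> (1 + t) * r\<^sup>2 + (1 + 1 / t) * d\<^sup>2"
  proof -
    \<comment> \<open>The gap in Young's inequality is a perfect square.\<close>
    have "(1 + t) * r\<^sup>2 + (1 + 1 / t) * d\<^sup>2 - (r + d)\<^sup>2 = (t * r - d)\<^sup>2 / t"
      using t by (simp add: power2_eq_square field_simps)
    moreover have "0 \<le> (t * r - d)\<^sup>2 / t" using t by simp
    ultimately show ?thesis by linarith
  qed
  moreover have "(1 + 1 / t) * d\<^sup>2 \<le> (1 + 1 / t) * (dual_norm q b * lq_norm q (fst u - fst v))\<^sup>2"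
    using abs_inner_le_dual_norm[OF q, of b "fst v - fst u"] t
      mult_nonneg_nonneg[OF dual_norm_nonneg[OF q, of b] lq_norm_nonneg[OF q, of "fst u - fst v"]]
    by (intro mult_left_mono) (auto simp: d_def abs_le_square_iff[symmetric] lq_norm_minus_commute[OF q])
  ultimately show ?thesis
    using y by (simp add: case_prod_unfold r_def d_def power_mult_distrib inner_diff_right algebra_simps)
qed

text \<open>Both classification losses are 1-Lipschitz functions of the margin
  \<open>y * (b \<bullet> x)\<close>; the factor \<open>\<bar>snd v\<bar>\<close> appears because
  responses are arbitrary reals here.\<close>

lemma loss_classification_le:
  assumes q: "1 < q" and s: "s \<noteq> Linear_Regression" and y: "snd u = snd v"
  shows "loss s b u \<le> loss s b v + \<bar>snd v\<bar> * dual_norm q b * lq_norm q (fst u - fst v)"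
proof -
  define a c where "a = snd v * (b \<bullet> fst v)" and "c = snd v * (b \<bullet> fst u)"
  have log: "ln (1 + exp (- c)) \<le> ln (1 + exp (- a)) + \<bar>a - c\<bar>"
  proof -
    \<comment> \<open>The Lipschitz bound of the logistic loss, in exponential form.\<close>
    have "1 + exp (- c) \<le> (1 + exp (- a)) * exp \<bar>a - c\<bar>"
    proof -
      have "exp (- c) \<le> exp (- a) * exp \<bar>a - c\<bar>" by (simp flip: exp_add)
      moreover have "1 \<le> exp \<bar>a - c\<bar>" by simp
      ultimately show ?thesis unfolding distrib_right by linarith
    qed
    moreover have "0 < 1 + exp (- c)" "0 < 1 + exp (- a)" by (simp_all add: add_pos_pos)
    ultimately have "ln (1 + exp (- c)) \<le> ln ((1 + exp (- a)) * exp \<bar>a - c\<bar>)"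
      by (subst ln_le_cancel_iff) auto
    then show ?thesis using \<open>0 < 1 + exp (- a)\<close> by (simp add: ln_mult)
  qed
  have "loss s b u \<le> loss s b v + \<bar>a - c\<bar>"
    using s y log by (cases s) (auto simp: case_prod_unfold a_def c_def)
  also have "\<bar>a - c\<bar> = \<bar>snd v\<bar> * \<bar>b \<bullet> (fst v - fst u)\<bar>"
    by (simp add: a_def c_def inner_diff_right abs_mult flip: right_diff_distrib)
  also have "\<dots> \<le> \<bar>snd v\<bar> * (dual_norm q b * lq_norm q (fst u - fst v))"
    using abs_inner_le_dual_norm[OF q, of b "fst v - fst u"]
    by (intro mult_left_mono) (auto simp: lq_norm_minus_commute[OF q])
  finally show ?thesis by simp
qed

subsection \<open>Robust risk around an empirical measure\<close>

definition empirical_loss :: "setting \<Rightarrow> nat \<Rightarrow> (nat \<Rightarrow> 'd::finite point) \<Rightarrow> real ^ 'd \<Rightarrow> real" where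
  "empirical_loss s n z b = (\<Sum>i<n. loss s b (z i)) / real n"

lemma empirical_loss_nonneg: "0 \<le> empirical_loss s n z b"
  by (auto simp: empirical_loss_def intro!: divide_nonneg_nonneg sum_nonneg loss_nonneg)

lemma nn_integral_uniform_count_measure_lessThan:
  assumes "0 < n" "\<And>i. 0 \<le> f i"
  shows "(\<integral>\<^sup>+ i. ennreal (f i) \<partial>uniform_count_measure {..<n::nat}) = ennreal ((\<Sum>i<n. f i) / real n)"
  using assms
  by (simp add: uniform_count_measure_def nn_integral_point_measure_finite sum_divide_distrib
      flip: ennreal_mult sum_ennreal)

lemma measurable_uniform_count_measure [measurable, simp]:
  "f \<in> measurable (uniform_count_measure A) N \<longleftrightarrow> f \<in> A \<rightarrow> space N"
  by (subst measurable_cong_sets[OF sets_uniform_count_measure_count_space refl]) simp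

lemma nn_integral_empirical:
  assumes "0 < n" "\<And>x. 0 \<le> f x" "f \<in> borel_measurable borel"
  shows "(\<integral>\<^sup>+ x. ennreal (f x) \<partial>empirical n z) = ennreal ((\<Sum>i<n. f (z i)) / real n)"
  using assms unfolding empirical_def
  by (subst nn_integral_distr) (auto simp: nn_integral_uniform_count_measure_lessThan)

lemma expected_loss_empirical:
  "0 < n \<Longrightarrow> expected_loss s (empirical n z) b = ennreal (empirical_loss s n z b)"
  unfolding expected_loss_def empirical_loss_def
  by (rule nn_integral_empirical) (auto simp: loss_nonneg)

lemma AE_empirical:
  assumes "S \<in> sets borel" "\<And>i. i < n \<Longrightarrow> z i \<in> S"
  shows "AE x in empirical n z. x \<in> S"
  unfolding empirical_def
  using assms by (subst AE_distr_iff) (auto intro!: AE_I2 simp: space_uniform_count_measure)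

text \<open>The largest Lipschitz constant in the sample, per unit of dual norm. Keeping it, instead
  of assuming labels of modulus 1, makes the closed form of the worst case valid for every sample
  and not just almost surely.\<close>

definition max_abs_response :: "nat \<Rightarrow> (nat \<Rightarrow> 'd::finite point) \<Rightarrow> real" where
  "max_abs_response n z = (MAX i\<in>{..<n}. \<bar>snd (z i)\<bar>)"

lemma max_abs_response_ge: "i < n \<Longrightarrow> \<bar>snd (z i)\<bar> \<le> max_abs_response n z"
  unfolding max_abs_response_def by (rule Max_ge) auto

lemma max_abs_response_attained:
  assumes "0 < n"
  obtains i where "i < n" "\<bar>snd (z i)\<bar> = max_abs_response n z"
proof -
  have "max_abs_response n z \<in> (\<lambda>i. \<bar>snd (z i)\<bar>) ` {..<n}"
    unfolding max_abs_response_def using assms by (intro Max_in) auto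
  with that show ?thesis by auto
qed

lemma max_abs_response_nonneg: "0 < n \<Longrightarrow> 0 \<le> max_abs_response n z"
  by (metis abs_ge_zero max_abs_response_attained)

text \<open>The value of the inner supremum of the robust risk: the budget \<open>\<delta>\<close> is best spent on moving
  points along the direction dual to \<open>b\<close>, proportionally to the residuals for the quadratic cost,
  and by moving a vanishing mass very far for the linear cost.\<close>

definition worst_case_risk ::
    "setting \<Rightarrow> ereal \<Rightarrow> real \<Rightarrow> nat \<Rightarrow> (nat \<Rightarrow> 'd::finite point) \<Rightarrow> real ^ 'd \<Rightarrow> real" where
  "worst_case_risk s q \<delta> n z b =
    (if s = Linear_Regression then (sqrt (empirical_loss s n z b) + sqrt \<delta> * dual_norm q b)\<^sup>2
     else empirical_loss s n z b + \<delta> * dual_norm q b * max_abs_response n z)"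

section \<open>Upper bound for the worst case over the ambiguity set\<close>

text \<open>The right-hand side is minimal at \<open>t = c / a\<close>, with value
  \<open>(a + c)\<^sup>2\<close>.\<close>

lemma le_add_square:
  assumes a: "0 \<le> a" and c: "0 \<le> c"
    and le: "\<And>t. 0 < t \<Longrightarrow> e \<le> (1 + t) * a\<^sup>2 + (1 + 1 / t) * c\<^sup>2"
  shows "e \<le> (a + c :: real)\<^sup>2"
proof (rule tendsto_lowerbound)
  show "((\<lambda>h. (a + c) * (a + c + 2 * h)) \<longlongrightarrow> (a + c)\<^sup>2) (at_right 0)"
    by (auto intro!: tendsto_eq_intros simp: power2_eq_square)
  show "eventually (\<lambda>h. e \<le> (a + c) * (a + c + 2 * h)) (at_right 0)"
  proof (rule eventually_at_right_less[THEN eventually_mono])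
    fix h :: real assume h: "0 < h"
    \<comment> \<open>Adding \<open>h\<close> to both terms of the optimal ratio
      \<open>c / a\<close> keeps \<open>t\<close> positive and finite when \<open>a\<close> or
      \<open>c\<close> vanishes; the error disappears as \<open>h\<close> tends to 0.\<close>
    define t where "t = (c + h) / (a + h)"
    have ah: "0 < a + h" "0 < c + h" using a c h by auto
    have "(1 + t) * a\<^sup>2 = (a + c + 2 * h) * (a * (a / (a + h)))"
      using ah by (simp add: t_def field_simps power2_eq_square)
    also have "\<dots> \<le> (a + c + 2 * h) * (a * 1)"
      using ah a c h by (intro mult_left_mono) auto
    finally have 1: "(1 + t) * a\<^sup>2 \<le> (a + c + 2 * h) * a" by simp
    have "(1 + 1 / t) * c\<^sup>2 = (a + c + 2 * h) * (c * (c / (c + h)))"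
      using ah by (simp add: t_def field_simps power2_eq_square)
    also have "\<dots> \<le> (a + c + 2 * h) * (c * 1)"
      using ah a c h by (intro mult_left_mono) auto
    finally have 2: "(1 + 1 / t) * c\<^sup>2 \<le> (a + c + 2 * h) * c" by simp
    have "0 < t" using ah by (simp add: t_def)
    from le[OF this] 1 2 show "e \<le> (a + c) * (a + c + 2 * h)"
      by (simp add: algebra_simps)
  qed
qed simp

lemma sets_bounded_response: "{v :: 'd::finite point. \<bar>snd v\<bar> \<le> c} \<in> sets borel"
  by (intro borel_closed closed_Collect_le continuous_intros)

text \<open>Young's bound is integrated in both directions, the second one after exchanging the two
  points by symmetry of the norm.\<close>

lemma
  fixes P :: "'d::finite point measure"
  assumes q: "1 < q" and \<delta>: "0 \<le> \<delta>" and n: "0 < n"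
    and fin: "transport_cost (cost Linear_Regression q) P (empirical n z) \<le> ennreal \<delta>" and t: "0 < t"
  shows expected_loss_linear_le: "expected_loss Linear_Regression P b
      \<le> ennreal ((1 + t) * empirical_loss Linear_Regression n z b + (1 + 1 / t) * (dual_norm q b)\<^sup>2 * \<delta>)"
    and empirical_loss_linear_le: "ennreal (empirical_loss Linear_Regression n z b)
      \<le> ennreal (1 + t) * expected_loss Linear_Regression P b + ennreal ((1 + 1 / t) * (dual_norm q b)\<^sup>2 * \<delta>)"
proof -
  let ?s = Linear_Regression and ?K = "(1 + 1 / t) * (dual_norm q b)\<^sup>2"
  have K: "0 \<le> ?K" using t by simp
  have lr: "loss ?s b u \<le> (1 + t) * loss ?s b v + ?K * lq_norm q (fst u - fst v) ^ rho ?s"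
    if "snd u = snd v" for u v
    using loss_linear_le[OF q t that, of b] by simp
  have lr': "loss ?s b v \<le> (1 + t) * loss ?s b u + ?K * lq_norm q (fst u - fst v) ^ rho ?s"
    if "snd u = snd v" for u v
    using lr[OF that[symmetric]] lq_norm_minus_commute[OF q, of "fst u" "fst v"] by simp
  have "expected_loss ?s P b \<le> (\<integral>\<^sup>+ v. ennreal ((1 + t) * loss ?s b v) \<partial>empirical n z) + ennreal (?K * \<delta>)"
    unfolding expected_loss_def
    by (rule nn_integral_le_transport(1)[OF q fin K \<delta>, of UNIV])
      (use t lr in \<open>auto simp: loss_nonneg simp del: loss.simps rho.simps\<close>)
  also have "(\<integral>\<^sup>+ v. ennreal ((1 + t) * loss ?s b v) \<partial>empirical n z) = ennreal ((1 + t) * empirical_loss ?s n z b)"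
    using n t by (subst nn_integral_empirical)
      (auto simp: loss_nonneg empirical_loss_def sum_distrib_left simp del: loss.simps)
  finally show "expected_loss ?s P b \<le> ennreal ((1 + t) * empirical_loss ?s n z b + ?K * \<delta>)"
    using t \<delta> by (subst ennreal_plus) (auto simp: empirical_loss_nonneg)
  show "ennreal (empirical_loss ?s n z b) \<le> ennreal (1 + t) * expected_loss ?s P b + ennreal (?K * \<delta>)"
  proof (cases "sets P = sets borel")
    case True
    have [measurable_cong]: "sets P = sets borel" by fact
    have "(\<integral>\<^sup>+ v. ennreal (loss ?s b v) \<partial>empirical n z) \<le> (\<integral>\<^sup>+ u. ennreal ((1 + t) * loss ?s b u) \<partial>P) + ennreal (?K * \<delta>)"
      by (rule nn_integral_le_transport(2)[OF q fin K \<delta>, of UNIV])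
        (use t lr' in \<open>auto simp: loss_nonneg simp del: loss.simps rho.simps\<close>)
    also have "(\<integral>\<^sup>+ u. ennreal ((1 + t) * loss ?s b u) \<partial>P) = ennreal (1 + t) * expected_loss ?s P b"
      using t by (simp add: ennreal_mult loss_nonneg nn_integral_cmult expected_loss_def del: loss.simps)
    finally show ?thesis
      using expected_loss_empirical[OF n, of ?s z b] by (simp add: expected_loss_def)
  next
    case False
    \<comment> \<open>Without a coupling the transport cost is infinite, contradicting
      \<open>fin\<close>.\<close>
    then have "couplings P (empirical n z) = {}" by (auto simp: couplings_def)
    with fin show ?thesis by (simp add: transport_cost_def top_unique)
  qed
qed

text \<open>The Lipschitz constants \<open>\<bar>y\<bar> * dual_norm q b\<close> are bounded
  uniformly on \<open>?S\<close>, which has full empirical mass.\<close>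

lemma
  fixes P :: "'d::finite point measure"
  assumes q: "1 < q" and s: "s \<noteq> Linear_Regression" and \<delta>: "0 \<le> \<delta>" and n: "0 < n"
    and fin: "transport_cost (cost s q) P (empirical n z) \<le> ennreal \<delta>"
  shows expected_loss_classification_le: "expected_loss s P b
      \<le> ennreal (empirical_loss s n z b + \<delta> * dual_norm q b * max_abs_response n z)"
    and empirical_loss_classification_le: "ennreal (empirical_loss s n z b)
      \<le> expected_loss s P b + ennreal (\<delta> * dual_norm q b * max_abs_response n z)"
proof -
  let ?S = "{v :: 'd point. \<bar>snd v\<bar> \<le> max_abs_response n z}"
  let ?K = "dual_norm q b * max_abs_response n z"
  have K: "0 \<le> ?K" by (intro mult_nonneg_nonneg dual_norm_nonneg[OF q] max_abs_response_nonneg[OF n])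
  have rho: "rho s = 1" using s by (cases s) auto
  have S: "AE v in empirical n z. v \<in> ?S"
    by (rule AE_empirical[OF sets_bounded_response]) (auto intro: max_abs_response_ge)
  have le: "loss s b u \<le> loss s b v + ?K * lq_norm q (fst u - fst v) ^ rho s"
    if "snd u = snd v" "v \<in> ?S" for u v :: "'d point"
  proof -
    have "\<bar>snd v\<bar> * dual_norm q b * lq_norm q (fst u - fst v) \<le> max_abs_response n z * dual_norm q b * lq_norm q (fst u - fst v)"
      using that by (intro mult_right_mono dual_norm_nonneg[OF q] lq_norm_nonneg[OF q]) auto
    then show ?thesis using loss_classification_le[OF q s that(1), of b] rho by (simp add: mult_ac)
  qed
  have le': "loss s b v \<le> loss s b u + ?K * lq_norm q (fst u - fst v) ^ rho s"
    if "snd u = snd v" "v \<in> ?S" for u v :: "'d point"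
    using le[of v u] that lq_norm_minus_commute[OF q, of "fst u" "fst v"] by simp
  have "expected_loss s P b \<le> expected_loss s (empirical n z) b + ennreal (?K * \<delta>)"
    unfolding expected_loss_def
    by (rule nn_integral_le_transport(1)[OF q fin K \<delta> S sets_bounded_response])
      (use le in \<open>auto simp: loss_nonneg\<close>)
  then show "expected_loss s P b \<le> ennreal (empirical_loss s n z b + \<delta> * dual_norm q b * max_abs_response n z)"
    using K \<delta> n by (simp add: expected_loss_empirical empirical_loss_nonneg mult_ac ennreal_plus[symmetric] del: ennreal_plus)
  have "expected_loss s (empirical n z) b \<le> expected_loss s P b + ennreal (?K * \<delta>)"
    unfolding expected_loss_def
    by (rule nn_integral_le_transport(2)[OF q fin K \<delta> S sets_bounded_response])
      (use le' in \<open>auto simp: loss_nonneg\<close>)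
  then show "ennreal (empirical_loss s n z b) \<le> expected_loss s P b + ennreal (\<delta> * dual_norm q b * max_abs_response n z)"
    using n by (simp add: expected_loss_empirical mult_ac)
qed

lemma expected_loss_le_worst_case_risk:
  assumes q: "1 < q" and \<delta>: "0 \<le> \<delta>" and n: "0 < n"
    and P: "P \<in> ambiguity_set (cost s q) \<delta> (empirical n z)"
  shows "expected_loss s P b \<le> ennreal (worst_case_risk s q \<delta> n z b)"
proof (cases "s = Linear_Regression")
  case True
  have fin: "transport_cost (cost Linear_Regression q) P (empirical n z) \<le> ennreal \<delta>"
    using P True by (auto simp: ambiguity_set_def)
  note le = expected_loss_linear_le[OF q \<delta> n fin, of _ b]
  \<comment> \<open>Any fixed \<open>t\<close> gives finiteness, so the optimization over
    \<open>t\<close> can take place in the reals.\<close>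
  have "expected_loss Linear_Regression P b < \<infinity>"
    using le_less_trans[OF le[of 1]] by simp
  then obtain e where e: "expected_loss Linear_Regression P b = ennreal e" "0 \<le> e"
    by (cases "expected_loss Linear_Regression P b") auto
  have "e \<le> (sqrt (empirical_loss Linear_Regression n z b) + sqrt \<delta> * dual_norm q b)\<^sup>2"
  proof (rule le_add_square)
    fix t :: real assume t: "0 < t"
    have "0 \<le> (1 + t) * empirical_loss Linear_Regression n z b + (1 + 1 / t) * (dual_norm q b)\<^sup>2 * \<delta>"
      using t \<delta> by (intro add_nonneg_nonneg mult_nonneg_nonneg empirical_loss_nonneg) auto
    then show "e \<le> (1 + t) * (sqrt (empirical_loss Linear_Regression n z b))\<^sup>2 + (1 + 1 / t) * (sqrt \<delta> * dual_norm q b)\<^sup>2"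
      using le[OF t] e \<delta> by (simp add: empirical_loss_nonneg power_mult_distrib mult_ac)
  qed (auto simp: empirical_loss_nonneg \<delta> dual_norm_nonneg[OF q])
  then show ?thesis using True e by (simp add: worst_case_risk_def)
next
  case False
  have "transport_cost (cost s q) P (empirical n z) \<le> ennreal \<delta>"
    using P by (simp add: ambiguity_set_def)
  from expected_loss_classification_le[OF q False \<delta> n this, of b] False show ?thesis
    by (simp add: worst_case_risk_def)
qed

section \<open>Perturbed samples that attain or approach the worst case\<close>

lemma borel_prob_empirical: "0 < n \<Longrightarrow> borel_prob (empirical n z)"
  unfolding borel_prob_def empirical_def
  by (auto intro!: prob_space.prob_space_distr prob_space_uniform_count_measure)

text \<open>The two samples are coupled index by index, with the uniform index as common probability
  space.\<close>

lemma transport_cost_empirical_le: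
  assumes q: "1 < q" and n: "0 < n" and y: "\<And>i. i < n \<Longrightarrow> snd (z' i) = snd (z i)"
  shows "transport_cost (cost s q) (empirical n z') (empirical n z)
    \<le> ennreal ((\<Sum>i<n. lq_norm q (fst (z' i) - fst (z i)) ^ rho s) / real n)"
proof -
  have "transport_cost (cost s q) (empirical n z') (empirical n z)
      \<le> (\<integral>\<^sup>+ i. cost s q (z' i) (z i) \<partial>uniform_count_measure {..<n})"
    unfolding empirical_def using n
    by (intro transport_cost_distr_le prob_space_uniform_count_measure) auto
  also have "\<dots> = (\<integral>\<^sup>+ i. ennreal (lq_norm q (fst (z' i) - fst (z i)) ^ rho s) \<partial>uniform_count_measure {..<n})"
    using y by (intro nn_integral_cong)
      (simp add: space_uniform_count_measure cost_eq ennreal_power lq_norm_nonneg[OF q])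
  also have "\<dots> = ennreal ((\<Sum>i<n. lq_norm q (fst (z' i) - fst (z i)) ^ rho s) / real n)"
    using n by (intro nn_integral_uniform_count_measure_lessThan) (auto simp: lq_norm_nonneg[OF q])
  finally show ?thesis .
qed

text \<open>All adversarial samples have this shape: one direction \<open>w\<close> of the unit
  ball, and an individual displacement \<open>k i\<close> whose average power has to fit the
  budget.\<close>

lemma shifted_empirical_in_ambiguity_set:
  assumes q: "1 < q" and n: "0 < n" and w: "lq_norm q w \<le> 1"
    and le: "(\<Sum>i<n. \<bar>k i\<bar> ^ rho s) / real n \<le> \<delta>"
  shows "empirical n (\<lambda>i. (fst (z i) - k i *\<^sub>R w, snd (z i))) \<in> ambiguity_set (cost s q) \<delta> (empirical n z)"
proof -
  have "transport_cost (cost s q) (empirical n (\<lambda>i. (fst (z i) - k i *\<^sub>R w, snd (z i)))) (empirical n z)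
      \<le> ennreal ((\<Sum>i<n. lq_norm q (- k i *\<^sub>R w) ^ rho s) / real n)"
    using transport_cost_empirical_le[OF q n, of "\<lambda>i. (fst (z i) - k i *\<^sub>R w, snd (z i))" z s] by simp
  also have "\<dots> \<le> ennreal ((\<Sum>i<n. \<bar>k i\<bar> ^ rho s) / real n)"
  proof (intro ennreal_leI divide_right_mono sum_mono power_mono)
    fix i
    show "lq_norm q (- k i *\<^sub>R w) \<le> \<bar>k i\<bar>"
      using mult_left_mono[OF w, of "\<bar>k i\<bar>"] lq_norm_scaleR[OF q, of "- k i" w] by simp
  qed (auto simp: lq_norm_nonneg[OF q] simp del: scaleR_minus_left)
  also have "\<dots> \<le> ennreal \<delta>" by (rule ennreal_leI[OF le])
  finally show ?thesis using borel_prob_empirical[OF n] by (simp add: ambiguity_set_def)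
qed

text \<open>Displacements proportional to the residuals scale every residual by the same factor,
  which is the equality case of the Minkowski inequality. The direction \<open>w\<close> is
  arbitrary; the supremum over \<open>w\<close> is taken later.\<close>

lemma worst_case_linear_attained:
  fixes w :: "real ^ 'd::finite"
  assumes q: "1 < q" and n: "0 < n" and \<delta>: "0 < \<delta>" and w: "lq_norm q w \<le> 1"
  shows "ennreal ((sqrt (empirical_loss Linear_Regression n z b) + sqrt \<delta> * (b \<bullet> w))\<^sup>2)
    \<le> (SUP P\<in>ambiguity_set (cost Linear_Regression q) \<delta> (empirical n z). expected_loss Linear_Regression P b)"
proof -
  define A where "A = empirical_loss Linear_Regression n z b"
  define r where "r i = snd (z i) - b \<bullet> fst (z i)" for i
  have A: "A = (\<Sum>i<n. (r i)\<^sup>2) / real n"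
    by (simp add: A_def empirical_loss_def r_def case_prod_unfold)
  have A0: "0 \<le> A" unfolding A_def by (rule empirical_loss_nonneg)
  \<comment> \<open>The factor \<open>sqrt (\<delta> / A)\<close> makes the mean square displacement
    equal to \<open>\<delta>\<close>. If \<open>A = 0\<close> all residuals vanish, and a constant
    displacement spends the same budget.\<close>
  define k where "k i = (if A = 0 then sqrt \<delta> else sqrt (\<delta> / A) * r i)" for i
  have k: "(\<Sum>i<n. \<bar>k i\<bar> ^ rho Linear_Regression) / real n \<le> \<delta>"
  proof (cases "A = 0")
    case True
    then show ?thesis using \<delta> n by (simp add: k_def)
  next
    case False
    then have "(\<Sum>i<n. \<bar>k i\<bar> ^ rho Linear_Regression) = \<delta> / A * (\<Sum>i<n. (r i)\<^sup>2)"
      using A0 \<delta> by (simp add: k_def power_mult_distrib sum_distrib_left)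
    also have "(\<Sum>i<n. (r i)\<^sup>2) = A * real n" using A n by simp
    finally show ?thesis using False n by simp
  qed
  have "(\<Sum>i<n. (r i + k i * (b \<bullet> w))\<^sup>2) / real n = (sqrt A + sqrt \<delta> * (b \<bullet> w))\<^sup>2"
  proof (cases "A = 0")
    case True
    then have "(\<Sum>i<n. (r i)\<^sup>2) = 0" using A n by simp
    then have "\<forall>i\<in>{..<n}. (r i)\<^sup>2 = 0" by (subst (asm) sum_nonneg_eq_0_iff) auto
    then show ?thesis using True n by (simp add: k_def)
  next
    case False
    have "(\<Sum>i<n. (r i + k i * (b \<bullet> w))\<^sup>2) = (\<Sum>i<n. (1 + sqrt (\<delta> / A) * (b \<bullet> w))\<^sup>2 * (r i)\<^sup>2)"
      using False by (intro sum.cong) (simp_all add: k_def power2_eq_square algebra_simps)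
    also have "\<dots> = (1 + sqrt (\<delta> / A) * (b \<bullet> w))\<^sup>2 * (A * real n)"
      using A n by (simp flip: sum_distrib_left)
    also have "\<dots> = (sqrt A * (1 + sqrt (\<delta> / A) * (b \<bullet> w)))\<^sup>2 * real n"
      using A0 by (simp add: power_mult_distrib)
    also have "sqrt A * (1 + sqrt (\<delta> / A) * (b \<bullet> w)) = sqrt A + sqrt \<delta> * (b \<bullet> w)"
      using False A0 by (simp add: real_sqrt_divide field_simps)
    finally show ?thesis using n by simp
  qed
  moreover have "loss Linear_Regression b (fst (z i) - k i *\<^sub>R w, snd (z i)) = (r i + k i * (b \<bullet> w))\<^sup>2" for i
    by (simp add: r_def inner_diff_right diff_diff_eq2 diff_add_eq)
  ultimately have "expected_loss Linear_Regression (empirical n (\<lambda>i. (fst (z i) - k i *\<^sub>R w, snd (z i)))) b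
      = ennreal ((sqrt A + sqrt \<delta> * (b \<bullet> w))\<^sup>2)"
    using n by (simp only: expected_loss_empirical empirical_loss_def)
  then show ?thesis
    using SUP_upper[OF shifted_empirical_in_ambiguity_set[OF q n w k, of z],
        of "\<lambda>P. expected_loss Linear_Regression P b"]
    unfolding A_def by simp
qed

lemma sum_mod_lessThan: "(\<Sum>i<k * n. f (i mod n)) = of_nat k * (\<Sum>i<n. f i :: 'a::semiring_1)" for n :: nat
proof -
  have "(\<Sum>i<k * n. f (i mod n)) = (\<Sum>m<k. \<Sum>i\<in>{m * n..<m * n + n}. f (i mod n))"
    by (rule sum.nat_group[symmetric])
  also have "\<dots> = (\<Sum>m<k. \<Sum>i<n. f i)"
  proof (rule sum.cong[OF refl])
    fix m
    show "(\<Sum>i\<in>{m * n..<m * n + n}. f (i mod n)) = (\<Sum>i<n. f i)"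
      using sum.shift_bounds_nat_ivl[of "\<lambda>i. f (i mod n)" 0 "m * n" n]
      by (simp add: add.commute lessThan_atLeast0)
  qed
  finally show ?thesis by simp
qed

text \<open>Repetition keeps the law but splits each atom into \<open>k\<close> parts that can be
  moved separately.\<close>

lemma empirical_repeat:
  assumes n: "0 < n" and k: "0 < k"
  shows "empirical (k * n) (\<lambda>i. z (i mod n)) = empirical n z"
proof (rule measure_eqI)
  show "sets (empirical (k * n) (\<lambda>i. z (i mod n))) = sets (empirical n z)"
    by (simp add: empirical_def)
next
  fix S assume "S \<in> sets (empirical (k * n) (\<lambda>i. z (i mod n)))"
  then have S: "S \<in> sets borel" by (simp add: empirical_def)
  have em: "emeasure (empirical m y) S = ennreal ((\<Sum>i<m. indicator S (y i)) / real m)" if "0 < m" for m y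
  proof -
    have "emeasure (empirical m y) S = (\<integral>\<^sup>+ x. ennreal (indicator S x) \<partial>empirical m y)"
      using S by (simp add: ennreal_indicator empirical_def)
    also have "\<dots> = ennreal ((\<Sum>i<m. indicator S (y i)) / real m)"
      using S by (intro nn_integral_empirical that) auto
    finally show ?thesis .
  qed
  show "emeasure (empirical (k * n) (\<lambda>i. z (i mod n))) S = emeasure (empirical n z) S"
    using n k by (simp add: em sum_mod_lessThan[of "\<lambda>i. indicator S (z i) :: real"])
qed

text \<open>Both losses dominate the negative margin, so a far displacement gains at the full
  Lipschitz rate up to a constant.\<close>

lemma loss_classification_ge:
  assumes "s \<noteq> Linear_Regression"
  shows "- snd v * (b \<bullet> fst v) \<le> loss s b v"
proof (cases s)
  case Logistic_Regression
  have "- snd v * (b \<bullet> fst v) = ln (exp (- snd v * (b \<bullet> fst v)))" by simp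
  also have "\<dots> \<le> ln (1 + exp (- snd v * (b \<bullet> fst v)))"
    by (subst ln_le_cancel_iff) (auto simp: add_pos_pos)
  finally show ?thesis using Logistic_Regression by (simp add: case_prod_unfold)
qed (use assms in \<open>auto simp: case_prod_unfold\<close>)

text \<open>Repeating the sample \<open>k\<close> times makes it possible to move the mass \<open>1 / (k * n)\<close> of a point with
  the largest response over a distance \<open>\<delta> * k * n\<close>.\<close>

lemma worst_case_classification_approached:
  fixes w :: "real ^ 'd::finite"
  assumes q: "1 < q" and s: "s \<noteq> Linear_Regression" and n: "0 < n" and \<delta>: "0 < \<delta>" and w: "lq_norm q w \<le> 1"
  obtains c where "\<And>k. 0 < k \<Longrightarrow>
    ennreal (empirical_loss s n z b + \<delta> * (b \<bullet> w) * max_abs_response n z - c / real k)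
    \<le> (SUP P\<in>ambiguity_set (cost s q) \<delta> (empirical n z). expected_loss s P b)"
proof -
  obtain j where j: "j < n" "\<bar>snd (z j)\<bar> = max_abs_response n z"
    using max_abs_response_attained[OF n] by blast
  \<comment> \<open>The gap between the loss of point \<open>j\<close> and its negative margin, the
    only loss in the linear lower bound. It is charged to a single copy, hence the final error
    \<open>c / real k\<close>.\<close>
  define c where "c = (snd (z j) * (b \<bullet> fst (z j)) + loss s b (z j)) / real n"
  have rho: "rho s = 1" using s by (cases s) auto
  have "ennreal (empirical_loss s n z b + \<delta> * (b \<bullet> w) * max_abs_response n z - c / real k)
    \<le> (SUP P\<in>ambiguity_set (cost s q) \<delta> (empirical n z). expected_loss s P b)" if k: "0 < k" for k :: nat
  proof -
    define m where "m = k * n"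
    define y where "y = (\<lambda>i. z (i mod n))"
    \<comment> \<open>One copy of mass \<open>1 / real m\<close> takes the whole budget, so it may
      move by \<open>\<delta> * real m\<close>; the sign turns its response into
      \<open>\<bar>snd (z j)\<bar>\<close>.\<close>
    define d where "d = (\<lambda>i. if i = j then sgn (snd (z j)) * \<delta> * real m else 0)"
    define y' where "y' = (\<lambda>i. (fst (y i) - d i *\<^sub>R w, snd (y i)))"
    have m: "0 < m" using n k by (simp add: m_def)
    have "n \<le> m" using k by (simp add: m_def)
    then have jm: "j \<in> {..<m}" using j by simp
    have yj: "y j = z j" using j by (simp add: y_def)
    have "(\<Sum>i<m. \<bar>d i\<bar> ^ rho s) = \<bar>d j\<bar> ^ rho s + (\<Sum>i\<in>{..<m} - {j}. \<bar>d i\<bar> ^ rho s)"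
      using jm by (subst sum.remove) auto
    also have "(\<Sum>i\<in>{..<m} - {j}. \<bar>d i\<bar> ^ rho s) = 0"
      by (rule sum.neutral) (auto simp: d_def rho)
    also have "\<bar>d j\<bar> ^ rho s + 0 \<le> \<delta> * real m"
      using \<delta> by (auto simp: d_def rho abs_mult sgn_if)
    finally have "(\<Sum>i<m. \<bar>d i\<bar> ^ rho s) / real m \<le> \<delta>" using m by (simp add: field_simps)
    then have mem: "empirical m y' \<in> ambiguity_set (cost s q) \<delta> (empirical n z)"
      using shifted_empirical_in_ambiguity_set[OF q m w, of d s \<delta> y] empirical_repeat[OF n k, of z]
      by (simp add: y'_def y_def m_def)
    have "(\<Sum>i<m. loss s b (y' i)) - (\<Sum>i<m. loss s b (y i)) = (\<Sum>i<m. loss s b (y' i) - loss s b (y i))"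
      by (simp add: sum_subtractf)
    also have "\<dots> = (loss s b (y' j) - loss s b (y j)) + (\<Sum>i\<in>{..<m} - {j}. loss s b (y' i) - loss s b (y i))"
      using jm by (subst sum.remove) auto
    also have "(\<Sum>i\<in>{..<m} - {j}. loss s b (y' i) - loss s b (y i)) = 0"
      by (rule sum.neutral) (auto simp: y'_def d_def)
    finally have diff: "(\<Sum>i<m. loss s b (y' i)) = (\<Sum>i<m. loss s b (y i)) + (loss s b (y' j) - loss s b (z j))"
      using yj by simp
    have "- snd (y' j) * (b \<bullet> fst (y' j)) \<le> loss s b (y' j)" by (rule loss_classification_ge[OF s])
    moreover have "- snd (y' j) * (b \<bullet> fst (y' j))
        = - snd (z j) * (b \<bullet> fst (z j)) + \<delta> * real m * (b \<bullet> w) * max_abs_response n z"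
      using j(2) yj
      by (simp add: y'_def d_def inner_diff_right algebra_simps abs_sgn[of "snd (z j)"])
    ultimately have "(\<Sum>i<m. loss s b (y i)) + \<delta> * real m * (b \<bullet> w) * max_abs_response n z - c * real n
        \<le> (\<Sum>i<m. loss s b (y' i))"
      using diff n by (simp add: c_def)
    then have "((\<Sum>i<m. loss s b (y i)) + \<delta> * real m * (b \<bullet> w) * max_abs_response n z - c * real n) / real m
        \<le> empirical_loss s m y' b"
      unfolding empirical_loss_def by (intro divide_right_mono) auto
    moreover have "(\<Sum>i<m. loss s b (y i)) = real k * (real n * empirical_loss s n z b)"
      using n by (simp add: m_def y_def empirical_loss_def sum_mod_lessThan[of "\<lambda>i. loss s b (z i)"])
    moreover have "(real k * (real n * empirical_loss s n z b) + \<delta> * real m * (b \<bullet> w) * max_abs_response n z - c * real n) / real m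
        = empirical_loss s n z b + \<delta> * (b \<bullet> w) * max_abs_response n z - c / real k"
      using n k by (simp add: m_def field_simps)
    ultimately have "empirical_loss s n z b + \<delta> * (b \<bullet> w) * max_abs_response n z - c / real k \<le> empirical_loss s m y' b"
      by simp
    then have "ennreal (empirical_loss s n z b + \<delta> * (b \<bullet> w) * max_abs_response n z - c / real k)
        \<le> expected_loss s (empirical m y') b"
      by (simp add: expected_loss_empirical[OF m] ennreal_leI)
    also have "\<dots> \<le> (SUP P\<in>ambiguity_set (cost s q) \<delta> (empirical n z). expected_loss s P b)"
      by (rule SUP_upper[OF mem])
    finally show ?thesis .
  qed
  then show ?thesis by (rule that)
qed

text \<open>The bounds for single directions \<open>w\<close> are solved for
  \<open>b \<bullet> w\<close>; being uniform in \<open>w\<close>, they pass to the dual norm. An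
  infinite supremum is trivial.\<close>

lemma worst_case_risk_le_SUP:
  fixes b :: "real ^ 'd::finite"
  assumes q: "1 < q" and n: "0 < n" and \<delta>: "0 < \<delta>"
  shows "ennreal (worst_case_risk s q \<delta> n z b)
    \<le> (SUP P\<in>ambiguity_set (cost s q) \<delta> (empirical n z). expected_loss s P b)" (is "_ \<le> ?S")
proof (cases ?S)
  case (real \<sigma>)
  show ?thesis
  proof (cases "s = Linear_Regression")
    case True
    have le: "sqrt \<delta> * (b \<bullet> w) \<le> sqrt \<sigma> - sqrt (empirical_loss s n z b)" if "lq_norm q w \<le> 1" for w
    proof -
      have "(sqrt (empirical_loss s n z b) + sqrt \<delta> * (b \<bullet> w))\<^sup>2 \<le> \<sigma>"
        using worst_case_linear_attained[OF q n \<delta> that, of z b] real True by simp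
      then show ?thesis using real_le_rsqrt[of "sqrt (empirical_loss s n z b) + sqrt \<delta> * (b \<bullet> w)" \<sigma>] by simp
    qed
    have "dual_norm q b \<le> (sqrt \<sigma> - sqrt (empirical_loss s n z b)) / sqrt \<delta>"
      using le \<delta> by (intro dual_norm_leI[OF q]) (simp add: field_simps)
    then have "sqrt (empirical_loss s n z b) + sqrt \<delta> * dual_norm q b \<le> sqrt \<sigma>"
      using \<delta> by (simp add: field_simps)
    then have "(sqrt (empirical_loss s n z b) + sqrt \<delta> * dual_norm q b)\<^sup>2 \<le> (sqrt \<sigma>)\<^sup>2"
      using \<delta> by (intro power_mono) (auto simp: empirical_loss_nonneg dual_norm_nonneg[OF q])
    then show ?thesis using True real by (simp add: worst_case_risk_def)
  next
    case False
    have le: "empirical_loss s n z b + \<delta> * (b \<bullet> w) * max_abs_response n z \<le> \<sigma>" if w: "lq_norm q w \<le> 1" for w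
    proof -
      obtain c where c: "\<And>k. 0 < k \<Longrightarrow>
          ennreal (empirical_loss s n z b + \<delta> * (b \<bullet> w) * max_abs_response n z - c / real k) \<le> ?S"
        using worst_case_classification_approached[OF q False n \<delta> w, of z b] by blast
      \<comment> \<open>The mass of the moved copy tends to 0, and with it the error term.\<close>
      have "(\<lambda>k. empirical_loss s n z b + \<delta> * (b \<bullet> w) * max_abs_response n z - c / real k)
          \<longlonglongrightarrow> empirical_loss s n z b + \<delta> * (b \<bullet> w) * max_abs_response n z - 0"
        by (intro tendsto_intros lim_const_over_n)
      moreover have "empirical_loss s n z b + \<delta> * (b \<bullet> w) * max_abs_response n z - c / real k \<le> \<sigma>" if "1 \<le> k" for k
        using c[of k] real that by simp
      ultimately show ?thesis by (intro LIMSEQ_le_const2) auto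
    qed
    have "\<delta> * dual_norm q b * max_abs_response n z \<le> \<sigma> - empirical_loss s n z b"
    proof (cases "max_abs_response n z = 0")
      case True
      then show ?thesis using le[of 0] by (simp add: lq_norm_zero[OF q])
    next
      case nz: False
      then have pos: "0 < max_abs_response n z" using max_abs_response_nonneg[OF n, of z] by simp
      have "dual_norm q b \<le> (\<sigma> - empirical_loss s n z b) / (\<delta> * max_abs_response n z)"
        using le \<delta> pos by (intro dual_norm_leI[OF q]) (simp add: field_simps)
      then show ?thesis using \<delta> pos by (simp add: field_simps)
    qed
    then show ?thesis using False real by (simp add: worst_case_risk_def)
  qed
next
  case top
  show ?thesis unfolding top by (rule top_greatest)
qed

lemma SUP_ambiguity_set_eq:
  assumes "1 < q" "0 < n" "0 < \<delta>"
  shows "(SUP P\<in>ambiguity_set (cost s q) \<delta> (empirical n z). expected_loss s P b)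
    = ennreal (worst_case_risk s q \<delta> n z b)"
  using assms by (intro antisym SUP_least expected_loss_le_worst_case_risk worst_case_risk_le_SUP) auto

subsection \<open>Measurability of the robust risk\<close>

text \<open>The open set where \<open>f\<close> is below \<open>f x + e\<close> contains a point of
  \<open>D\<close>.\<close>

lemma INF_ennreal_dense:
  fixes f :: "'b::topological_space \<Rightarrow> real"
  assumes f: "continuous_on UNIV f"
    and dense: "\<And>X. open X \<Longrightarrow> X \<noteq> {} \<Longrightarrow> \<exists>d\<in>D. d \<in> X"
  shows "(INF x. ennreal (f x)) = (INF x\<in>D. ennreal (f x))"
proof (rule antisym)
  show "(INF x. ennreal (f x)) \<le> (INF x\<in>D. ennreal (f x))" by (rule INF_superset_mono) auto
  show "(INF x\<in>D. ennreal (f x)) \<le> (INF x. ennreal (f x))"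
  proof (rule INF_greatest)
    fix x
    show "(INF x\<in>D. ennreal (f x)) \<le> ennreal (f x)"
    proof (rule ennreal_le_epsilon)
      fix e :: real assume e: "0 < e"
      have "open (f -` {..<f x + e})" using f by (simp add: continuous_on_open_vimage)
      moreover have "x \<in> f -` {..<f x + e}" using e by simp
      then have "f -` {..<f x + e} \<noteq> {}" by (metis empty_iff)
      ultimately have "\<exists>d\<in>D. d \<in> f -` {..<f x + e}" by (rule dense)
      then obtain d where d: "d \<in> D" "f d < f x + e" by auto
      have "ennreal (f d) \<le> ennreal (f x + e)" using d by (intro ennreal_leI) auto
      also have "\<dots> \<le> ennreal (f x) + ennreal e"
        \<comment> \<open>\<open>ennreal\<close> truncates at 0, so the sum splits only up to an
          inequality when \<open>f x\<close> is negative.\<close>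
        using e by (cases "0 \<le> f x") (auto simp: ennreal_plus ennreal_neg intro!: ennreal_leI)
      finally show "(INF x\<in>D. ennreal (f x)) \<le> ennreal (f x) + ennreal e"
        by (rule INF_lower2[OF d(1)])
    qed
  qed
qed

lemma continuous_loss: "continuous_on UNIV (\<lambda>b. loss s b z)"
proof -
  have "1 + exp c \<noteq> 0" for c :: real using exp_gt_zero[of c] by linarith
  then show ?thesis
    by (cases s) (auto simp: case_prod_unfold intro!: continuous_intros)
qed

lemma continuous_worst_case_risk:
  fixes z :: "nat \<Rightarrow> 'd::finite point"
  assumes q: "1 < q"
  shows "continuous_on UNIV (worst_case_risk s q \<delta> n z)"
proof -
  have [continuous_intros]: "continuous_on UNIV (empirical_loss s n z)"
    unfolding empirical_loss_def by (cases "n = 0") (auto intro!: continuous_intros continuous_loss)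
  note [continuous_intros] = continuous_dual_norm[OF q]
  have "continuous_on UNIV (\<lambda>b. (sqrt (empirical_loss s n z b) + sqrt \<delta> * dual_norm q b)\<^sup>2)"
    and "continuous_on UNIV (\<lambda>b. empirical_loss s n z b + \<delta> * dual_norm q b * max_abs_response n z)"
    by (intro continuous_intros)+
  then show ?thesis
    unfolding worst_case_risk_def by (cases "s = Linear_Regression") simp_all
qed

lemma robust_risk_empirical:
  assumes "1 < q" "0 < n" "0 < \<delta>"
  shows "robust_risk s q \<delta> (empirical n z) = (INF b. ennreal (worst_case_risk s q \<delta> n z b))"
  unfolding robust_risk_def SUP_ambiguity_set_eq[OF assms] ..

text \<open>It makes the event of the theorem measurable; \<open>measure\<close> assigns 0 to any
  other set.\<close>

lemma borel_measurable_robust_risk: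
  fixes Z :: "nat \<Rightarrow> 'a \<Rightarrow> 'd::finite point"
  assumes q: "1 < q" and n: "0 < n" and \<delta>: "0 < \<delta>" and Z: "\<And>i. Z i \<in> borel_measurable M"
  shows "(\<lambda>\<omega>. robust_risk s q \<delta> (empirical n (\<lambda>i. Z i \<omega>))) \<in> borel_measurable M"
proof -
  obtain D :: "(real ^ 'd) set" where D: "countable D" "\<And>X. open X \<Longrightarrow> X \<noteq> {} \<Longrightarrow> \<exists>d\<in>D. d \<in> X"
    using countable_dense_exists by blast
  have snd: "snd \<in> borel_measurable (borel :: 'd point measure)"
    by (intro borel_measurable_continuous_onI continuous_intros)
  have [measurable]: "(\<lambda>\<omega>. snd (Z i \<omega>)) \<in> borel_measurable M" "(\<lambda>\<omega>. loss s b (Z i \<omega>)) \<in> borel_measurable M" for i b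
    using measurable_compose[OF Z snd] measurable_compose[OF Z borel_measurable_loss] by auto
  have [measurable]: "(\<lambda>\<omega>. max_abs_response n (\<lambda>i. Z i \<omega>)) \<in> borel_measurable M"
    unfolding max_abs_response_def by measurable
  have [measurable]: "(\<lambda>\<omega>. worst_case_risk s q \<delta> n (\<lambda>i. Z i \<omega>) b) \<in> borel_measurable M" for b
    unfolding worst_case_risk_def empirical_loss_def by measurable
  have "(\<lambda>\<omega>. INF b\<in>D. ennreal (worst_case_risk s q \<delta> n (\<lambda>i. Z i \<omega>) b)) \<in> borel_measurable M"
    using D(1) by measurable
  moreover have "robust_risk s q \<delta> (empirical n z) = (INF b\<in>D. ennreal (worst_case_risk s q \<delta> n z b))" for z
    unfolding robust_risk_empirical[OF q n \<delta>]
    by (rule INF_ennreal_dense[OF continuous_worst_case_risk[OF q] D(2)])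
  ultimately show ?thesis by simp
qed

subsection \<open>Stationary measures\<close>

text \<open>Each loss is a convex function of one real variable composed with an affine function of
  the parameter.\<close>

lemma convex_on_loss: "convex_on UNIV (\<lambda>b. loss s b z)"
proof -
  obtain x y where z: "z = (x, y)" by (cases z)
  have "convex_on UNIV (\<lambda>c::real. ln (1 + exp c))"
  proof (rule convex_on_realI)
    fix c :: real
    \<comment> \<open>In this form the derivative is visibly increasing.\<close>
    show "((\<lambda>c. ln (1 + exp c)) has_real_derivative (1 - 1 / (1 + exp c))) (at c)"
    proof -
      have "0 < 1 + exp c" by (simp add: add_pos_pos)
      then show ?thesis by (auto intro!: derivative_eq_intros simp: field_simps)
    qed
  next
    fix c d :: real assume "c \<le> d"
    then show "1 - 1 / (1 + exp c) \<le> 1 - 1 / (1 + exp d)"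
      by (auto intro!: divide_left_mono mult_pos_pos add_pos_pos)
  qed simp
  moreover have "convex_on UNIV (\<lambda>c::real. c\<^sup>2)" by (rule convex_power2)
  moreover have "convex_on UNIV (\<lambda>c::real. max 0 (1 + c))"
  proof (rule convex_onI)
    fix t c d :: real assume t: "0 < t" "t < 1"
    have "1 + ((1 - t) * c + t * d) = (1 - t) * (1 + c) + t * (1 + d)" by (simp add: algebra_simps)
    also have "\<dots> \<le> (1 - t) * max 0 (1 + c) + t * max 0 (1 + d)"
      using t by (intro add_mono mult_left_mono) auto
    finally show "max 0 (1 + ((1 - t) *\<^sub>R c + t *\<^sub>R d)) \<le> (1 - t) * max 0 (1 + c) + t * max 0 (1 + d)"
      using t by simp
  qed simp
  moreover have "convex_on UNIV (\<lambda>b. g (a * (b \<bullet> x) + e))" if g: "convex_on UNIV g" for g :: "real \<Rightarrow> real" and a e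
  proof (rule convex_onI)
    fix t :: real and b c :: "real ^ 'a" assume t: "0 < t" "t < 1"
    have "a * (((1 - t) *\<^sub>R b + t *\<^sub>R c) \<bullet> x) + e = (1 - t) *\<^sub>R (a * (b \<bullet> x) + e) + t *\<^sub>R (a * (c \<bullet> x) + e)"
      by (simp add: inner_add_left algebra_simps)
    then show "g (a * (((1 - t) *\<^sub>R b + t *\<^sub>R c) \<bullet> x) + e) \<le> (1 - t) * g (a * (b \<bullet> x) + e) + t * g (a * (c \<bullet> x) + e)"
      using convex_onD[OF g, of t "a * (b \<bullet> x) + e" "a * (c \<bullet> x) + e"] t by simp
  qed simp
  ultimately have "convex_on UNIV (\<lambda>b. ln (1 + exp (- y * (b \<bullet> x) + 0)))"
      "convex_on UNIV (\<lambda>b. (- 1 * (b \<bullet> x) + y)\<^sup>2)"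
      "convex_on UNIV (\<lambda>b. max 0 (1 + (- y * (b \<bullet> x) + 0)))"
    by blast+
  then show ?thesis by (cases s) (simp_all add: z)
qed

lemma expected_loss_eq_mean_loss:
  "integrable P (loss s b) \<Longrightarrow> expected_loss s P b = ennreal (mean_loss s P b)"
  unfolding expected_loss_def mean_loss_def by (rule nn_integral_eq_integral) (auto simp: loss_nonneg)

lemma mean_loss_nonneg: "0 \<le> mean_loss s P b"
  unfolding mean_loss_def by (simp add: loss_nonneg)

text \<open>On the line through \<open>b\<close> and \<open>b'\<close> the mean loss is a convex
  function \<open>g\<close> with derivative 0 at 0, so it lies above its horizontal tangent.\<close>

lemma stationary_imp_minimal:
  fixes P :: "'d::finite point measure"
  assumes "stationary s b P"
  shows "expected_loss s P b \<le> expected_loss s P b'"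
proof -
  have [simp]: "integrable P (loss s c)" for c
    using assms by (auto simp: stationary_def)
  have D: "GDERIV (mean_loss s P) b :> 0"
    using assms by (auto simp: stationary_def)
  define g where "g t = mean_loss s P (b + t *\<^sub>R (b' - b))" for t
  have conv: "convex_on UNIV g"
  proof (rule convex_onI)
    fix t x y :: real assume t: "0 < t" "t < 1"
    let ?c = "\<lambda>x. b + x *\<^sub>R (b' - b)"
    have eq: "?c ((1 - t) *\<^sub>R x + t *\<^sub>R y) = (1 - t) *\<^sub>R ?c x + t *\<^sub>R ?c y" by (simp add: algebra_simps)
    have "g ((1 - t) *\<^sub>R x + t *\<^sub>R y) \<le> (\<integral>z. (1 - t) * loss s (?c x) z + t * loss s (?c y) z \<partial>P)"
      unfolding g_def mean_loss_def eq
      using t by (intro integral_mono) (auto intro!: convex_onD[OF convex_on_loss])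
    also have "\<dots> = (1 - t) * g x + t * g y" by (simp add: g_def mean_loss_def)
    finally show "g ((1 - t) *\<^sub>R x + t *\<^sub>R y) \<le> (1 - t) * g x + t * g y" .
  qed simp
  have "(mean_loss s P has_derivative (\<lambda>h. 0)) (at (b + 0 *\<^sub>R (b' - b)))"
    using D by (simp add: gderiv_def)
  moreover have "((\<lambda>t. b + t *\<^sub>R (b' - b)) has_derivative (\<lambda>t. t *\<^sub>R (b' - b))) (at 0)"
    by (auto intro!: derivative_eq_intros)
  ultimately have "(g has_derivative (\<lambda>t. 0)) (at 0)"
    unfolding g_def by (rule has_derivative_compose[rotated])
  moreover have "(\<lambda>t :: real. 0 :: real) = (*) 0" by auto
  ultimately have "(g has_field_derivative 0) (at 0)" by (simp only: has_field_derivative_def)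
  then have "g 1 - g 0 \<ge> 0 * (1 - 0)"
    by (intro convex_on_imp_above_tangent[OF conv]) auto
  then show ?thesis by (simp add: g_def expected_loss_eq_mean_loss ennreal_leI)
qed

text \<open>With all covariates moved to 0 the loss no longer depends on the parameter. Finiteness
  matters because \<open>enn2real\<close> would turn an infinite profile into 0.\<close>

lemma profile_empirical_less_top:
  assumes q: "1 < q" and n: "0 < n"
  shows "profile s q (empirical n z) b < \<infinity>"
proof -
  define z' :: "nat \<Rightarrow> 'a point" where "z' i = (0, snd (z i))" for i
  have z': "loss s c (z' i) = loss s a (z' i)" for a c i by (cases s) (auto simp: z'_def)
  have int: "integrable (empirical n z') (loss s c)" for c
  proof -
    have "integrable (uniform_count_measure {..<n}) (\<lambda>i. loss s c (z' i))"
      unfolding uniform_count_measure_def by (rule integrable_point_measure_finite) simp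
    then show ?thesis unfolding empirical_def by (subst integrable_distr_eq) simp_all
  qed
  have mean: "mean_loss s (empirical n z') c = (\<integral>i. loss s c (z' i) \<partial>uniform_count_measure {..<n})" for c
    unfolding mean_loss_def empirical_def by (rule integral_distr) simp_all
  have "mean_loss s (empirical n z') c = mean_loss s (empirical n z') 0" for c
    unfolding mean using z'[of c _ 0] by presburger
  then have const: "mean_loss s (empirical n z') = (\<lambda>c. mean_loss s (empirical n z') 0)" by (rule ext)
  have "GDERIV (mean_loss s (empirical n z')) b :> 0"
    by (subst const) (rule GDERIV_const)
  with int have "stationary s b (empirical n z')" by (simp add: stationary_def)
  then have "profile s q (empirical n z) b \<le> transport_cost (cost s q) (empirical n z') (empirical n z)"
    unfolding profile_def using borel_prob_empirical[OF n] by (intro INF_lower) auto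
  also have "\<dots> \<le> ennreal ((\<Sum>i<n. lq_norm q (fst (z' i) - fst (z i)) ^ rho s) / real n)"
    by (rule transport_cost_empirical_le[OF q n]) (simp add: z'_def)
  finally show ?thesis by (simp add: le_less_trans)
qed

subsection \<open>Concentration and quantiles\<close>

text \<open>The cross terms vanish by independence and centering.\<close>

lemma (in prob_space) second_moment_sum:
  fixes Y :: "nat \<Rightarrow> 'a \<Rightarrow> real"
  assumes indep: "indep_vars (\<lambda>_. borel) Y UNIV"
    and sq: "\<And>i. integrable M (\<lambda>x. (Y i x)\<^sup>2)"
    and mean: "\<And>i. expectation (Y i) = 0" and var: "\<And>i. expectation (\<lambda>x. (Y i x)\<^sup>2) = v"
  shows "integrable M (\<lambda>x. (\<Sum>i<n. Y i x)\<^sup>2)" "expectation (\<lambda>x. (\<Sum>i<n. Y i x)\<^sup>2) = real n * v"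
proof -
  have [measurable]: "Y i \<in> borel_measurable M" for i
    using indep by (simp add: indep_vars_def2)
  have int: "integrable M (Y i)" for i by (rule square_integrable_imp_integrable[OF _ sq]) simp
  have prod: "integrable M (\<lambda>x. Y i x * Y j x)" "expectation (\<lambda>x. Y i x * Y j x) = (if i = j then v else 0)" for i j
  proof -
    have "integrable M (\<lambda>x. Y i x * Y j x) \<and> expectation (\<lambda>x. Y i x * Y j x) = (if i = j then v else 0)"
    proof (cases "i = j")
      case True
      then show ?thesis using sq[of j] var[of j] by (simp add: power2_eq_square)
    next
      case False
      have ind: "indep_vars (\<lambda>_. borel) Y {i, j}" by (rule indep_vars_subset[OF indep]) simp
      have "integrable M (\<lambda>x. \<Prod>k\<in>{i, j}. Y k x)" by (rule indep_vars_integrable) (use ind int in auto)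
      moreover have "expectation (\<lambda>x. \<Prod>k\<in>{i, j}. Y k x) = (\<Prod>k\<in>{i, j}. expectation (Y k))"
        by (rule indep_vars_lebesgue_integral) (use ind int in auto)
      ultimately show ?thesis using False mean by simp
    qed
    then show "integrable M (\<lambda>x. Y i x * Y j x)" "expectation (\<lambda>x. Y i x * Y j x) = (if i = j then v else 0)" by auto
  qed
  have eq: "(\<Sum>i<n. Y i x)\<^sup>2 = (\<Sum>i<n. \<Sum>j<n. Y i x * Y j x)" for x
    by (simp add: power2_eq_square sum_product)
  show "integrable M (\<lambda>x. (\<Sum>i<n. Y i x)\<^sup>2)" unfolding eq by (intro Bochner_Integration.integrable_sum prod)
  show "expectation (\<lambda>x. (\<Sum>i<n. Y i x)\<^sup>2) = real n * v"
    unfolding eq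
    by (subst Bochner_Integration.integral_sum, intro Bochner_Integration.integrable_sum prod,
        subst Bochner_Integration.integral_sum, rule prod, simp add: prod(2))
qed

text \<open>Chebyshev's inequality for the centered sum at level \<open>K * sqrt n\<close>, where
  the factor \<open>n\<close> of the variance cancels.\<close>

lemma (in prob_space) sample_mean_deviation:
  fixes X :: "nat \<Rightarrow> 'a \<Rightarrow> real"
  assumes indep: "indep_vars (\<lambda>_. borel) X UNIV"
    and sq: "\<And>i. integrable M (\<lambda>x. (X i x)\<^sup>2)"
    and mean: "\<And>i. expectation (X i) = m" and var: "\<And>i. variance (X i) = v"
    and n: "0 < n" and K: "0 < K"
  shows "prob {x \<in> space M. K / sqrt (real n) \<le> \<bar>(\<Sum>i<n. X i x) / real n - m\<bar>} \<le> v / K\<^sup>2"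
proof -
  have [measurable]: "X i \<in> borel_measurable M" for i
    using indep by (simp add: indep_vars_def2)
  have int: "integrable M (X i)" for i by (rule square_integrable_imp_integrable[OF _ sq]) simp
  define Y where "Y i = (\<lambda>x. X i x - m)" for i
  have indepY: "indep_vars (\<lambda>_. borel) Y UNIV"
    unfolding Y_def using indep_vars_compose2[OF indep, of "\<lambda>_ y. y - m" "\<lambda>_. borel"] by simp
  have sqY: "integrable M (\<lambda>x. (Y i x)\<^sup>2)" for i
    using int sq by (simp add: Y_def power2_diff)
  have meanY: "expectation (Y i) = 0" for i using int mean by (simp add: Y_def prob_space)
  have varY: "expectation (\<lambda>x. (Y i x)\<^sup>2) = v" for i using var[of i] mean[of i] by (simp add: Y_def)
  note S = second_moment_sum[OF indepY sqY meanY varY, of n]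
  have [measurable]: "Y i \<in> borel_measurable M" for i unfolding Y_def by measurable
  have intY: "integrable M (Y i)" for i unfolding Y_def using int by simp
  have ES: "expectation (\<lambda>x. \<Sum>i<n. Y i x) = 0" using intY meanY by simp
  have "prob {x \<in> space M. K * sqrt (real n) \<le> \<bar>(\<Sum>i<n. Y i x) - expectation (\<lambda>x. \<Sum>i<n. Y i x)\<bar>}
      \<le> variance (\<lambda>x. \<Sum>i<n. Y i x) / (K * sqrt (real n))\<^sup>2"
    using n K S by (intro Chebyshev_inequality) auto
  also have "\<dots> = v / K\<^sup>2" using n S unfolding ES by (simp add: power_mult_distrib)
  also have "{x \<in> space M. K * sqrt (real n) \<le> \<bar>(\<Sum>i<n. Y i x) - expectation (\<lambda>x. \<Sum>i<n. Y i x)\<bar>}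
    = {x \<in> space M. K / sqrt (real n) \<le> \<bar>(\<Sum>i<n. X i x) / real n - m\<bar>}"
  proof -
    have "(\<Sum>i<n. Y i x) = real n * ((\<Sum>i<n. X i x) / real n - m)" for x
      using n by (simp add: Y_def sum_subtractf field_simps)
    then have "\<bar>\<Sum>i<n. Y i x\<bar> = sqrt (real n) * (sqrt (real n) * \<bar>(\<Sum>i<n. X i x) / real n - m\<bar>)" for x
      by (simp add: abs_mult)
    moreover have "K * sqrt (real n) \<le> sqrt (real n) * (sqrt (real n) * c) \<longleftrightarrow> K / sqrt (real n) \<le> c" for c
      using n mult_le_cancel_left_pos[of "sqrt (real n)" K "sqrt (real n) * c"]
      by (simp add: pos_divide_le_eq mult.commute)
    ultimately show ?thesis unfolding ES by simp
  qed
  finally show ?thesis .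
qed

text \<open>Weak convergence controls distribution functions only at continuity points. Two distinct
  attained levels leave an open interval of candidates below \<open>\<eta> \<alpha>\<close>, of
  which only countably many are discontinuities.\<close>

lemma (in real_distribution) isCont_cdf_below_quantile:
  assumes attained: "\<And>a. 1 / 2 < 1 - a \<Longrightarrow> 1 - a < 1 \<Longrightarrow> cdf M (\<eta> a) = 1 - a"
    and "0 < \<alpha>" "\<alpha> < \<alpha>'" "\<alpha>' < 1 / 2"
  obtains x where "x < \<eta> \<alpha>" "isCont (cdf M) x" "1 - \<alpha>' \<le> cdf M x"
proof -
  have cdf: "cdf M (\<eta> \<alpha>') = 1 - \<alpha>'" "cdf M (\<eta> \<alpha>) = 1 - \<alpha>" using assms by (auto intro!: attained)
  then have lt: "\<eta> \<alpha>' < \<eta> \<alpha>" using cdf_nondecreasing[of "\<eta> \<alpha>" "\<eta> \<alpha>'"] assms by linarith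
  have "mono (cdf M)" by (intro monoI cdf_nondecreasing)
  then have "countable {x. \<not> isCont (cdf M) x}" by (rule mono_ctble_discont)
  then have "\<not> {\<eta> \<alpha>'<..<\<eta> \<alpha>} \<subseteq> {x. \<not> isCont (cdf M) x}"
    using uncountable_open_interval[of "\<eta> \<alpha>'" "\<eta> \<alpha>"] lt countable_subset by blast
  then obtain x where x: "\<eta> \<alpha>' < x" "x < \<eta> \<alpha>" "isCont (cdf M) x" by auto
  with cdf_nondecreasing[of "\<eta> \<alpha>'" x] cdf(1) show ?thesis by (intro that) auto
qed

text \<open>Strictness of the bound provides a stationary measure inside the ball even if the
  infimum in the profile is not attained.\<close>

lemma ex_stationary_in_ambiguity_set:
  assumes q: "1 < q" and n: "0 < n"
    and lt: "real n powr (real (rho s) / 2) * enn2real (profile s q (empirical n z) b) < \<eta>"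
  obtains P where "P \<in> ambiguity_set (cost s q) (real n powr (- real (rho s) / 2) * \<eta>) (empirical n z)" "stationary s b P"
proof -
  let ?\<delta> = "real n powr (- real (rho s) / 2) * \<eta>"
  have "enn2real (profile s q (empirical n z) b) < ?\<delta>"
    using lt n by (simp add: powr_minus field_simps)
  then have "profile s q (empirical n z) b < ennreal ?\<delta>"
    using profile_empirical_less_top[OF q n, of s z b]
    by (cases "profile s q (empirical n z) b") (auto simp: ennreal_less_iff)
  then show ?thesis
    unfolding profile_def INF_less_iff
    by (auto simp: ambiguity_set_def intro!: that)
qed

subsection \<open>Deviation of the robust risk\<close>

text \<open>The deterministic core, for a fixed sample. One constant serves all settings; its last
  summand 1 makes the inequality strict.\<close>

lemma robust_risk_deviation:
  fixes b :: "real ^ 'd::finite" and z :: "nat \<Rightarrow> 'd point"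
  assumes q: "1 < q" and n: "0 < n" and \<eta>: "0 < \<eta>" and m: "0 \<le> m" and K: "0 \<le> K"
    and dev: "\<bar>empirical_loss s n z b - m\<bar> \<le> K / sqrt (real n)"
    and y: "s \<noteq> Linear_Regression \<Longrightarrow> max_abs_response n z \<le> 1"
    and profile: "scaled_profile s q (\<lambda>i _. z i) b n x < \<eta>"
  shows "\<exists>r\<ge>0. robust_risk s q (real n powr (- real (rho s) / 2) * \<eta>) (empirical n z) = ennreal r
    \<and> \<bar>m - r\<bar> < (2 * K + m + 2 * \<eta> * (\<Sum>i\<in>UNIV. \<bar>b $ i\<bar>)\<^sup>2 + \<eta> * (\<Sum>i\<in>UNIV. \<bar>b $ i\<bar>) + 1) / sqrt (real n)"
proof -
  define \<delta> where "\<delta> = real n powr (- real (rho s) / 2) * \<eta>"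
  define h where "h = 1 / sqrt (real n)"
  define A where "A = empirical_loss s n z b"
  define B where "B = (\<Sum>i\<in>UNIV. \<bar>b $ i\<bar>)"
  define D where "D = dual_norm q b"
  let ?C = "2 * K + m + 2 * \<eta> * B\<^sup>2 + \<eta> * B + 1"
  have h: "0 < h" "h \<le> 1" using n by (simp_all add: h_def)
  have hh: "h * h = 1 / real n" by (simp add: h_def)
  have \<delta>0: "0 < \<delta>" using \<eta> n by (simp add: \<delta>_def)
  have \<delta>_linear: "\<delta> = \<eta> * h\<^sup>2" if "s = Linear_Regression"
    using that n by (simp add: \<delta>_def hh power2_eq_square powr_minus powr_one inverse_eq_divide)
  have \<delta>_classification: "\<delta> = \<eta> * h" if "s \<noteq> Linear_Regression"
  proof -
    have "rho s = 1" using that by (cases s) auto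
    then show ?thesis using n
      by (simp add: \<delta>_def h_def powr_half_sqrt[symmetric] powr_minus inverse_eq_divide)
  qed
  have A0: "0 \<le> A" unfolding A_def by (rule empirical_loss_nonneg)
  have dev': "A \<le> m + K * h" "m \<le> A + K * h" using dev by (auto simp: A_def h_def abs_le_iff)
  have D: "0 \<le> D" "D \<le> B"
    unfolding D_def B_def by (rule dual_norm_nonneg[OF q] dual_norm_le_sum_abs[OF q])+
  then have DB: "D\<^sup>2 \<le> B\<^sup>2" by (rule power_mono[rotated])
  have y0: "0 \<le> max_abs_response n z" by (rule max_abs_response_nonneg[OF n])
  have \<eta>B: "0 \<le> \<eta> * B\<^sup>2" "0 \<le> \<eta> * B" using \<eta> D by auto

  \<comment> \<open>Upper bound: the infimum is at most the worst case at \<open>b\<close>.\<close>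
  have "robust_risk s q \<delta> (empirical n z) \<le> (SUP P\<in>ambiguity_set (cost s q) \<delta> (empirical n z). expected_loss s P b)"
    unfolding robust_risk_def by (rule INF_lower) simp
  then have le: "robust_risk s q \<delta> (empirical n z) \<le> ennreal (worst_case_risk s q \<delta> n z b)"
    by (simp add: SUP_ambiguity_set_eq[OF q n \<delta>0])
  then obtain r where r: "robust_risk s q \<delta> (empirical n z) = ennreal r" "0 \<le> r"
    by (cases "robust_risk s q \<delta> (empirical n z)") (auto simp: top_unique)
  have w0: "0 \<le> worst_case_risk s q \<delta> n z b"
    using A0 D y0 \<delta>0 by (auto simp: worst_case_risk_def A_def D_def)
  from le r w0 have "r \<le> worst_case_risk s q \<delta> n z b" by simp
  also have "\<dots> \<le> m + (2 * K + m + 2 * \<eta> * B\<^sup>2 + \<eta> * B) * h"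
  proof (cases "s = Linear_Regression")
    case True
    have sq: "sqrt \<delta> = sqrt \<eta> * h" using \<delta>_linear[OF True] h by (simp add: real_sqrt_mult)
    have "worst_case_risk s q \<delta> n z b = (sqrt A + sqrt \<eta> * h * D)\<^sup>2"
      using True by (simp add: worst_case_risk_def A_def D_def sq)
    also have "\<dots> = A + h * (2 * (sqrt A * (sqrt \<eta> * D))) + h * (h * (\<eta> * D\<^sup>2))"
      using A0 \<eta> by (simp add: power2_sum power_mult_distrib power2_eq_square[of h] algebra_simps)
    \<comment> \<open>The cross term is bounded by the arithmetic-geometric mean inequality, and one
      factor \<open>h\<close> by 1.\<close>
    also have "\<dots> \<le> A + h * (A + \<eta> * D\<^sup>2) + h * (1 * (\<eta> * D\<^sup>2))"
    proof (intro add_mono mult_left_mono mult_right_mono)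
      have "0 \<le> (sqrt A - sqrt \<eta> * D)\<^sup>2" by simp
      then show "2 * (sqrt A * (sqrt \<eta> * D)) \<le> A + \<eta> * D\<^sup>2"
        using A0 \<eta> by (simp add: power2_diff power_mult_distrib)
    qed (use h \<eta> in auto)
    also have "\<dots> \<le> (m + K * h) + h * ((m + K) + \<eta> * B\<^sup>2) + h * (\<eta> * B\<^sup>2)"
    proof -
      have "K * h \<le> K * 1" using h K by (intro mult_left_mono) auto
      with dev' have "A \<le> m + K" by simp
      then show ?thesis using h dev' DB \<eta> by (intro add_mono mult_left_mono) auto
    qed
    also have "\<dots> \<le> m + (2 * K + m + 2 * \<eta> * B\<^sup>2 + \<eta> * B) * h"
      using mult_nonneg_nonneg[OF \<eta>B(2), of h] h by (simp add: algebra_simps)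
    finally show ?thesis .
  next
    case False
    have "worst_case_risk s q \<delta> n z b = A + \<eta> * h * (D * max_abs_response n z)"
      using False by (simp add: worst_case_risk_def A_def D_def \<delta>_classification)
    also have "\<dots> \<le> A + \<eta> * h * (B * 1)"
      using \<eta> h D y[OF False] y0 by (intro add_left_mono mult_left_mono mult_mono) auto
    also have "\<dots> \<le> m + K * h + \<eta> * B * h" using dev' by simp
    also have "\<dots> \<le> m + (2 * K + m + 2 * \<eta> * B\<^sup>2 + \<eta> * B) * h"
      using mult_nonneg_nonneg[OF K, of h] mult_nonneg_nonneg[OF m, of h] mult_nonneg_nonneg[OF \<eta>B(1), of h] h
      by (simp add: algebra_simps)
    finally show ?thesis .
  qed
  finally have upper: "r - m < ?C * h" using h by (simp add: algebra_simps)

  \<comment> \<open>Lower bound: \<open>P\<close> belongs to the ball and has its minimal risk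
    \<open>e\<close> at \<open>b\<close>, so the worst case at every \<open>b'\<close> is at least
    \<open>e\<close>.\<close>
  obtain P where P: "P \<in> ambiguity_set (cost s q) \<delta> (empirical n z)" and st: "stationary s b P"
    using ex_stationary_in_ambiguity_set[OF q n] profile unfolding scaled_profile_def \<delta>_def by blast
  have fin: "transport_cost (cost s q) P (empirical n z) \<le> ennreal \<delta>"
    using P by (simp add: ambiguity_set_def)
  define e where "e = mean_loss s P b"
  have e: "expected_loss s P b = ennreal e" "0 \<le> e"
    using st by (auto simp: e_def stationary_def expected_loss_eq_mean_loss mean_loss_nonneg)
  have "ennreal e \<le> robust_risk s q \<delta> (empirical n z)"
    unfolding robust_risk_def e(1)[symmetric]
  proof (rule INF_greatest)
    fix b'
    have "expected_loss s P b \<le> expected_loss s P b'" by (rule stationary_imp_minimal[OF st])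
    also have "\<dots> \<le> (SUP P\<in>ambiguity_set (cost s q) \<delta> (empirical n z). expected_loss s P b')"
      by (rule SUP_upper[OF P])
    finally show "expected_loss s P b \<le> \<dots>" .
  qed
  then have er: "e \<le> r" using r by simp
  have "m - e < ?C * h"
  proof (cases "s = Linear_Regression")
    case True
    \<comment> \<open>With \<open>t = h\<close> both error terms have order \<open>h\<close>, since
      \<open>\<delta>\<close> is \<open>\<eta> * h\<^sup>2\<close> here.\<close>
    have A_le: "A \<le> (1 + h) * e + (1 + 1 / h) * D\<^sup>2 * \<delta>"
    proof -
      have "ennreal A \<le> ennreal (1 + h) * ennreal e + ennreal ((1 + 1 / h) * D\<^sup>2 * \<delta>)"
        using empirical_loss_linear_le[OF q less_imp_le[OF \<delta>0] n fin[unfolded True] h(1), of b] e True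
        by (simp add: A_def D_def)
      also have "\<dots> = ennreal ((1 + h) * e + (1 + 1 / h) * D\<^sup>2 * \<delta>)"
        using e h \<delta>0 by (subst ennreal_plus) (auto simp: ennreal_mult intro!: mult_nonneg_nonneg)
      finally show ?thesis
        using e h \<delta>0 by (subst (asm) ennreal_le_iff) (auto intro!: add_nonneg_nonneg mult_nonneg_nonneg)
    qed
    have "(1 + 1 / h) * D\<^sup>2 * \<delta> = (1 + h) * (\<eta> * D\<^sup>2) * h"
      using h by (simp add: \<delta>_linear[OF True] power2_eq_square field_simps)
    also have "\<dots> \<le> 2 * (\<eta> * B\<^sup>2) * h"
      using h \<eta> DB by (intro mult_right_mono mult_mono) auto
    finally have 1: "A \<le> e + h * e + 2 * (\<eta> * B\<^sup>2) * h" using A_le by (simp add: algebra_simps)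
    show ?thesis
    \<comment> \<open>For \<open>m \<le> e\<close> the bound is trivial; otherwise \<open>m\<close>
      controls the term \<open>h * e\<close>.\<close>
    proof (cases "m \<le> e")
      case True
      have "0 < ?C" using K m \<eta>B by simp
      then show ?thesis using True h mult_pos_pos[of ?C h] by linarith
    next
      case False
      then have "h * e \<le> h * m" using h by (intro mult_left_mono) auto
      then have "m - e \<le> K * h + h * m + 2 * (\<eta> * B\<^sup>2) * h" using 1 dev' by linarith
      also have "\<dots> < ?C * h"
        using mult_nonneg_nonneg[OF K, of h] mult_nonneg_nonneg[OF \<eta>B(2), of h] h
        by (simp add: algebra_simps)
      finally show ?thesis .
    qed
  next
    case False
    have "ennreal A \<le> ennreal e + ennreal (\<delta> * D * max_abs_response n z)"
      using empirical_loss_classification_le[OF q False less_imp_le[OF \<delta>0] n fin, of b] e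
      by (simp add: A_def D_def)
    also have "\<dots> = ennreal (e + \<delta> * D * max_abs_response n z)"
      using e \<delta>0 D y0 by (subst ennreal_plus) auto
    finally have "A \<le> e + \<delta> * D * max_abs_response n z"
      using e \<delta>0 D y0 by (subst (asm) ennreal_le_iff) auto
    also have "\<delta> * D * max_abs_response n z = \<eta> * h * (D * max_abs_response n z)"
      by (simp add: \<delta>_classification[OF False])
    also have "\<dots> \<le> \<eta> * h * (B * 1)"
      using \<eta> h D y[OF False] y0 by (intro mult_left_mono mult_mono) auto
    finally have "m - e \<le> K * h + \<eta> * B * h" using dev' by (simp add: mult_ac)
    also have "\<dots> < ?C * h"
      using mult_nonneg_nonneg[OF K, of h] mult_nonneg_nonneg[OF m, of h] mult_nonneg_nonneg[OF \<eta>B(1), of h] h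
      by (simp add: algebra_simps)
    finally show ?thesis .
  qed
  with er have lower: "m - r < ?C * h" by simp
  have "?C * h = ?C / sqrt (real n)" by (simp add: h_def)
  with upper lower r show ?thesis unfolding \<delta>_def[symmetric] B_def[symmetric]
    by (intro exI[of _ r]) (simp add: abs_less_iff)
qed

section \<open>From fixed samples to probabilities\<close>

lemma abs_response_le_1:
  assumes "response_model s P b" "s \<noteq> Linear_Regression"
  shows "AE z in P. \<bar>snd z\<bar> \<le> 1"
proof -
  have "AE z in P. snd z \<in> {-1, 1}" using assms by (cases s) auto
  then show ?thesis by eventually_elim auto
qed

text \<open>The event of the theorem contains, up to a null set, the event that the scaled profile stays
  below \<open>x < \<eta>\<close> minus a Chebyshev event of probability at most \<open>v / K\<^sup>2\<close>.\<close>

lemma prob_profile_le_prob_deviation: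
  fixes s :: setting and P :: "'d::finite point measure" and M :: "'a measure" and Z :: "nat \<Rightarrow> 'a \<Rightarrow> 'd point" and b :: "real ^ 'd"
  defines "m \<equiv> mean_loss s P b" and "v \<equiv> var_loss s P b" and "B \<equiv> \<Sum>i\<in>UNIV. \<bar>b $ i\<bar>"
  assumes q: "1 < q" and iid: "iid_sample M Z P" and resp: "response_model s P b"
    and opt: "optimal_parameter s P b" and sq: "integrable P (\<lambda>z. (loss s b z)\<^sup>2)"
    and meas [measurable]: "scaled_profile s q Z b n \<in> borel_measurable M"
    and n: "0 < n" and K: "0 < K" and \<eta>: "0 < \<eta>" and x: "x < \<eta>"
  shows "measure M {\<omega> \<in> space M. scaled_profile s q Z b n \<omega> \<le> x} - v / K\<^sup>2
    \<le> measure M {\<omega> \<in> space M. \<bar>enn2ereal (optimal_risk s P) -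
        enn2ereal (robust_risk s q (real n powr (- real (rho s) / 2) * \<eta>) (empirical n (\<lambda>i. Z i \<omega>)))\<bar>
      < ereal ((2 * K + m + 2 * \<eta> * B\<^sup>2 + \<eta> * B + 1) / sqrt (real n))}" (is "_ \<le> measure M ?E")
proof -
  interpret prob_space M using iid by (simp add: iid_sample_def)
  have indep: "indep_vars (\<lambda>_. borel) Z UNIV" and dist: "distr M borel (Z i) = P" for i
    using iid by (auto simp: iid_sample_def)
  have Z [measurable]: "Z i \<in> borel_measurable M" for i using indep by (simp add: indep_vars_def2)
  have sets [measurable_cong, simp]: "sets P = sets borel" using dist[of 0] by (metis sets_distr)
  interpret P: prob_space P using prob_space_distr[OF Z] dist by metis
  let ?\<delta> = "real n powr (- real (rho s) / 2) * \<eta>"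
  let ?W = "{\<omega> \<in> space M. scaled_profile s q Z b n \<omega> \<le> x}"
  let ?H = "{\<omega> \<in> space M. K / sqrt (real n) \<le> \<bar>(\<Sum>i<n. loss s b (Z i \<omega>)) / real n - m\<bar>}"
  have lossZ [measurable]: "(\<lambda>\<omega>. loss s b (Z i \<omega>)) \<in> borel_measurable M" for i
    by (rule measurable_compose[OF Z borel_measurable_loss])
  have int: "integrable P (loss s b)"
    by (rule P.square_integrable_imp_integrable[OF _ sq]) simp
  have optimal: "optimal_risk s P = ennreal m"
  proof -
    have "optimal_risk s P = expected_loss s P b"
      unfolding optimal_risk_def using opt
      by (intro antisym INF_lower INF_greatest) (auto simp: optimal_parameter_def)
    then show ?thesis using int by (simp add: expected_loss_eq_mean_loss m_def)
  qed
  have m: "0 \<le> m" unfolding m_def by (rule mean_loss_nonneg)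
  have \<delta>: "0 < ?\<delta>" using n \<eta> by simp
  have [measurable]: "(\<lambda>\<omega>. robust_risk s q ?\<delta> (empirical n (\<lambda>i. Z i \<omega>))) \<in> borel_measurable M"
    by (rule borel_measurable_robust_risk[OF q n \<delta> Z])
  have E [measurable]: "?E \<in> sets M" by measurable
  have H: "measure M ?H \<le> v / K\<^sup>2"
  proof (rule sample_mean_deviation[OF _ _ _ _ n K])
    show "indep_vars (\<lambda>_. borel) (\<lambda>i \<omega>. loss s b (Z i \<omega>)) UNIV"
      by (rule indep_vars_compose2[OF indep]) simp
    show "integrable M (\<lambda>\<omega>. (loss s b (Z i \<omega>))\<^sup>2)" for i
      using sq unfolding dist[of i, symmetric] by (subst (asm) integrable_distr_eq) simp_all
    show mean: "expectation (\<lambda>\<omega>. loss s b (Z i \<omega>)) = m" for i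
      unfolding m_def mean_loss_def by (subst dist[of i, symmetric], subst integral_distr) simp_all
    show "variance (\<lambda>\<omega>. loss s b (Z i \<omega>)) = v" for i
      unfolding mean unfolding v_def var_loss_def m_def[symmetric]
      by (subst dist[of i, symmetric], subst integral_distr) simp_all
  qed
  have "AE \<omega> in M. s \<noteq> Linear_Regression \<longrightarrow> \<bar>snd (Z i \<omega>)\<bar> \<le> 1" for i
  proof (cases "s = Linear_Regression")
    case False
    have "AE z in distr M borel (Z i). \<bar>snd z\<bar> \<le> 1"
      unfolding dist by (rule abs_response_le_1[OF resp False])
    then show ?thesis by (rule AE_distrD[OF Z, THEN AE_mp]) simp
  qed simp
  then have "AE \<omega> in M. \<forall>i. s \<noteq> Linear_Regression \<longrightarrow> \<bar>snd (Z i \<omega>)\<bar> \<le> 1"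
    by (simp add: AE_all_countable)
  then have "AE \<omega> in M. \<omega> \<in> ?W \<longrightarrow> \<omega> \<in> ?E \<union> ?H"
  proof eventually_elim
    case (elim \<omega>)
    show ?case
    proof (intro impI)
      assume W: "\<omega> \<in> ?W"
      show "\<omega> \<in> ?E \<union> ?H"
      proof (cases "\<omega> \<in> ?H")
        case False
        then have dev: "\<bar>empirical_loss s n (\<lambda>i. Z i \<omega>) b - m\<bar> \<le> K / sqrt (real n)"
          using W by (simp add: empirical_loss_def)
        have y: "max_abs_response n (\<lambda>i. Z i \<omega>) \<le> 1" if "s \<noteq> Linear_Regression"
          using elim that n unfolding max_abs_response_def by (subst Max_le_iff) auto
        \<comment> \<open>The realized sample is viewed as a constant sample on the one-point
          space.\<close>
        have "scaled_profile s q (\<lambda>i _. Z i \<omega>) b n () < \<eta>"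
          using W x by (simp add: scaled_profile_def)
        from robust_risk_deviation[OF q n \<eta> m less_imp_le[OF K] dev y this]
        show ?thesis using W m by (auto simp: optimal B_def)
      qed simp
    qed
  qed
  then have "measure M ?W \<le> measure M (?E \<union> ?H)"
    by (rule finite_measure_mono_AE) measurable
  also have "\<dots> \<le> measure M ?E + measure M ?H"
    by (rule measure_Un_le[OF E]) measurable
  finally show ?thesis using H by linarith
qed

text \<open>\<open>C\<close> is chosen after \<open>\<beta>\<close>, \<open>\<alpha>\<close> and
  \<open>\<eta>\<close> but before the setting, the law and the sample. The \<open>liminf\<close>
  gives the lower bound without asserting that the probabilities converge.\<close>

theorem theorem4:
  fixes \<beta> :: "real ^ 'd::finite" and \<alpha> \<eta> :: real
  assumes "1 / 2 < 1 - \<alpha>" and "1 - \<alpha> < 1"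
  shows "\<exists>C :: nat \<Rightarrow> real \<Rightarrow> real \<Rightarrow> real.
    (\<forall>r m v. 0 < C r m v) \<and>
    (\<forall>(s :: setting) (p :: ereal) (q :: ereal) (P :: 'd point measure)
       (M :: 'a measure) (Z :: nat \<Rightarrow> 'a \<Rightarrow> 'd point)
       (R :: real measure) (\<eta>q :: real \<Rightarrow> real).
       1 < q \<and> 1 / p + 1 / q = 1 \<and>
       iid_sample M Z P \<and>
       response_model s P \<beta> \<and>
       optimal_parameter s P \<beta> \<and>
       integrable P (\<lambda>z. (norm (fst z))\<^sup>2) \<and>
       integrable P (\<lambda>z. (loss s \<beta> z)\<^sup>2) \<and>
       converges_in_law M (scaled_profile s q Z \<beta>) R \<and>
       (\<forall>a. 1 / 2 < 1 - a \<and> 1 - a < 1 \<longrightarrow> cdf R (\<eta>q a) = 1 - a) \<and>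
       \<eta>q \<alpha> \<le> \<eta>
     \<longrightarrow>
       ereal (1 - 2 * \<alpha>) \<le> liminf (\<lambda>n. ereal (measure M {\<omega> \<in> space M.
         \<bar>enn2ereal (optimal_risk s P) -
          enn2ereal (robust_risk s q (real n powr (- real (rho s) / 2) * \<eta>)
            (empirical n (\<lambda>i. Z i \<omega>)))\<bar>
         < ereal (C (rho s) (mean_loss s P \<beta>) (var_loss s P \<beta>) / sqrt (real n))})))"
proof -
  have \<alpha>: "0 < \<alpha>" "\<alpha> < 1 / 2" using assms by auto
  define B where "B = (\<Sum>i\<in>UNIV. \<bar>\<beta> $ i\<bar>)"
  \<comment> \<open>Chosen so that the Chebyshev bound \<open>v / (K v)\<^sup>2\<close> is at most
    \<open>\<alpha> / 2\<close>; \<open>\<bar>v\<bar> + 1\<close> keeps it positive for every real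
    \<open>v\<close>. The absolute values in \<open>C\<close> serve the same purpose.\<close>
  define K where "K v = sqrt (2 * (\<bar>v\<bar> + 1) / \<alpha>)" for v
  define C :: "nat \<Rightarrow> real \<Rightarrow> real \<Rightarrow> real" where
    "C = (\<lambda>_ m v. 2 * K v + \<bar>m\<bar> + 2 * \<bar>\<eta>\<bar> * B\<^sup>2 + \<bar>\<eta>\<bar> * B + 1)"
  have B: "0 \<le> B" by (simp add: B_def sum_nonneg)
  have K: "0 < K v" "v / (K v)\<^sup>2 \<le> \<alpha> / 2" for v
  proof -
    show "0 < K v" using \<alpha> by (simp add: K_def)
    then have "0 < (K v)\<^sup>2" by simp
    moreover have "\<alpha> / 2 * (K v)\<^sup>2 = \<bar>v\<bar> + 1" using \<alpha> by (simp add: K_def)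
    ultimately show "v / (K v)\<^sup>2 \<le> \<alpha> / 2" by (subst pos_divide_le_eq) auto
  qed
  have C: "0 < C r m v" for r m v
    unfolding C_def using K(1)[of v] B by (intro add_nonneg_pos add_nonneg_nonneg) auto
  show ?thesis
  proof (intro exI[of _ C] conjI allI impI C, elim conjE)
    fix s p q and P :: "'d point measure" and M :: "'a measure" and Z :: "nat \<Rightarrow> 'a \<Rightarrow> 'd point"
      and R :: "real measure" and \<eta>q :: "real \<Rightarrow> real"
    assume q: "1 < q" and "1 / p + 1 / q = 1" and iid: "iid_sample M Z P" and resp: "response_model s P \<beta>"
      and opt: "optimal_parameter s P \<beta>" and "integrable P (\<lambda>z. (norm (fst z))\<^sup>2)"
      and sq: "integrable P (\<lambda>z. (loss s \<beta> z)\<^sup>2)"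
      and law: "converges_in_law M (scaled_profile s q Z \<beta>) R"
      and quantile: "\<forall>a. 1 / 2 < 1 - a \<and> 1 - a < 1 \<longrightarrow> cdf R (\<eta>q a) = 1 - a"
      and le: "\<eta>q \<alpha> \<le> \<eta>"
    let ?W = "scaled_profile s q Z \<beta>" and ?m = "mean_loss s P \<beta>" and ?v = "var_loss s P \<beta>"
    interpret R: real_distribution R using law by (simp add: converges_in_law_def)
    have W [measurable]: "?W n \<in> borel_measurable M" for n using law by (simp add: converges_in_law_def)
    \<comment> \<open>The smaller of the midpoints between \<open>\<alpha>\<close> and
      \<open>1 / 2\<close> and between \<open>\<alpha>\<close> and
      \<open>3 / 2 * \<alpha>\<close>.\<close>
    define \<alpha>' where "\<alpha>' = min ((\<alpha> + 1 / 2) / 2) (5 / 4 * \<alpha>)"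
    have \<alpha>': "\<alpha> < \<alpha>'" "\<alpha>' < 1 / 2" "\<alpha>' < 3 / 2 * \<alpha>" using \<alpha> by (auto simp: \<alpha>'_def min_def)
    obtain x where x: "x < \<eta>q \<alpha>" "isCont (cdf R) x" "1 - \<alpha>' \<le> cdf R x"
      using R.isCont_cdf_below_quantile[OF _ \<alpha>(1) \<alpha>'(1,2), of \<eta>q] quantile by blast
    have "(\<lambda>n. cdf (distr M borel (?W n)) x) \<longlonglongrightarrow> cdf R x"
      using law x(2) by (simp add: converges_in_law_def weak_conv_m_def weak_conv_def)
    moreover have "cdf (distr M borel (?W n)) x = measure M {\<omega> \<in> space M. ?W n \<omega> \<le> x}" for n
      unfolding cdf_def by (subst measure_distr) (auto intro!: arg_cong[where f = "measure M"])
    ultimately have lim: "(\<lambda>n. measure M {\<omega> \<in> space M. ?W n \<omega> \<le> x}) \<longlonglongrightarrow> cdf R x" by simp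
    \<comment> \<open>Scaled profiles are nonnegative, so a negative \<open>x\<close> would have
      limiting probability 0. This yields \<open>\<eta> > 0\<close>.\<close>
    have "0 \<le> x"
    proof (rule ccontr)
      assume "\<not> 0 \<le> x"
      moreover have "0 \<le> ?W n \<omega>" for n \<omega> by (simp add: scaled_profile_def)
      ultimately have "\<not> ?W n \<omega> \<le> x" for n \<omega> by (meson order_trans)
      then have "{\<omega> \<in> space M. ?W n \<omega> \<le> x} = {}" for n by blast
      then have "measure M {\<omega> \<in> space M. ?W n \<omega> \<le> x} = 0" for n by (simp only: measure_empty)
      with lim have "(\<lambda>n. 0) \<longlonglongrightarrow> cdf R x" by (simp only:)
      then have "cdf R x = 0" by (simp add: LIMSEQ_const_iff)
      then show False using x(3) \<alpha>' by simp
    qed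
    with x(1) le have \<eta>: "0 < \<eta>" "x < \<eta>" by auto
    have C_eq: "C (rho s) ?m ?v = 2 * K ?v + ?m + 2 * \<eta> * B\<^sup>2 + \<eta> * B + 1"
      using \<eta> mean_loss_nonneg[of s P \<beta>] by (simp add: C_def)
    \<comment> \<open>The profile event may lose \<open>3 / 2 * \<alpha>\<close>; the remaining
      \<open>\<alpha> / 2\<close> is left for Chebyshev.\<close>
    have "eventually (\<lambda>n. 1 - 3 / 2 * \<alpha> < measure M {\<omega> \<in> space M. ?W n \<omega> \<le> x}) sequentially"
      using x(3) \<alpha>' by (intro order_tendstoD(1)[OF lim]) auto
    then have "eventually (\<lambda>n. ereal (1 - 2 * \<alpha>) \<le> ereal (measure M {\<omega> \<in> space M.
         \<bar>enn2ereal (optimal_risk s P) -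
          enn2ereal (robust_risk s q (real n powr (- real (rho s) / 2) * \<eta>)
            (empirical n (\<lambda>i. Z i \<omega>)))\<bar>
         < ereal (C (rho s) ?m ?v / sqrt (real n))})) sequentially"
      using eventually_gt_at_top[of 0]
    proof eventually_elim
      case (elim n)
      then have "1 - 2 * \<alpha> \<le> measure M {\<omega> \<in> space M. ?W n \<omega> \<le> x} - ?v / (K ?v)\<^sup>2"
        using K(2)[of ?v] by linarith
      also note prob_profile_le_prob_deviation[OF q iid resp opt sq W \<open>0 < n\<close> K(1)[of ?v] \<eta>, folded B_def]
      finally show ?case unfolding C_eq ereal_less_eq .
    qed
    then show "ereal (1 - 2 * \<alpha>) \<le> liminf (\<lambda>n. ereal (measure M {\<omega> \<in> space M.
         \<bar>enn2ereal (optimal_risk s P) -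
          enn2ereal (robust_risk s q (real n powr (- real (rho s) / 2) * \<eta>)
            (empirical n (\<lambda>i. Z i \<omega>)))\<bar>
         < ereal (C (rho s) (mean_loss s P \<beta>) (var_loss s P \<beta>) / sqrt (real n))}))"
      by (rule Liminf_bounded)
  qed
qed

end
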